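(* Let $(T^\bullet,\delta^\bullet):\mathcal C\to\mathcal D$ be a cohomological functor and $n\in\mathbb Z$. For a short exact sequence $0\to A\to B\to C\to0$ in $\mathcal C$ and $k\in\mathbb N$ denote by $\varepsilon^{-k}:S^{-k}T^{n+k}(C)\to S^{-k+1}T^{n+k}(A)$ the associated connecting homomorphism of left satellite functors. Then the $n$-th connecting homomorphism of the satellite functor construction $\widehat T^\bullet$ is $$\widehat\delta^n=\varinjlim_{k\in\mathbb N}\varepsilon^{-k}:\ \widehat T^n(C)\to\widehat T^{n+1}(A),$$ where the morphisms $\varepsilon^{-k}$ are connected over the transition morphisms $S^{-k}\underline\delta^{n+k}:S^{-k}T^{n+k}\to S^{-k-1}T^{n+k+1}$ (evaluated at $C$) on the source and $S^{-k+1}\underline\delta^{n+k}:S^{-k+1}T^{n+k}\to S^{-k}T^{n+k+1}$ (evaluated at $A$) on the target. In particular, $\underline\delta^n:T^n\to S^{-1}T^{n+1}$ is a natural transformation for every $n\in\mathbb Z$.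
   Context: Standing assumptions: $\mathcal C$ is an abelian category with enough projectives; $\mathcal D$ is an abelian category in which all direct limits (colimits over directed sets) exist and are exact. A cohomological functor $(T^\bullet,\delta^\bullet):\mathcal C\to\mathcal D$ is a family of additive functors $(T^n)_{n\in\mathbb Z}$ with, for each short exact sequence $0\to A\to B\to C\to0$, connecting homomorphisms $\delta^n:T^n(C)\to T^{n+1}(A)$, natural in the sequence, giving a long exact sequence. Morphisms are families of natural transformations commuting with connecting homomorphisms. Left satellites: for an additive functor $F:\mathcal C\to\mathcal D$ and $M\in\mathcal C$ choose $0\to K\to P\to M\to0$ exact with $P$ projective and put $S^{-1}F(M)=\mathrm{Ker}(F(K)\to F(P))$ (independent of choices up to canonical isomorphism); morphisms $M'\to M$ act via lifts $P'\to P$ and the induced $K'\to K$. $S^0F=F$, $S^{-k}F=S^{-1}(S^{-k+1}F)$. For a natural transformation $\varphi:F\to G$, $S^{-1}\varphi(M)$ is the restriction of $\varphi(K)$ to the kernels, $S^0\varphi=\varphi$ and $S^{-k}\varphi=S^{-1}(S^{-k+1}\varphi)$. For $0\to A\to B\to C\to0$ exact and $k\ge0$, $\varepsilon^{-k-1}:S^{-k-1}F(C)\to S^{-k}F(A)$ is the composite of the kernel inclusion $S^{-k-1}F(C)\to S^{-k}F(K)$ with $S^{-k}F(h^* )$, where $0\to K\to P\to C\to0$ is exact with $P$ projective, $h:P\to B$ lifts $\mathrm{id}_C$, and $h^*:K\to A$ is induced by $h$. For $0\to K\to P\to M\to0$ exact with $P$ projective, $\delta^n:T^n(M)\to T^{n+1}(K)$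 has image in $\mathrm{Ker}(T^{n+1}(K)\to T^{n+1}(P))$, so it factors as $T^n(M)\xrightarrow{\underline\delta^n}S^{-1}T^{n+1}(M)\hookrightarrow T^{n+1}(K)$; this defines $\underline\delta^n$. Satellite functor construction: for $m\in\mathbb N_0$ let $T^\bullet\langle m\rangle$ be the cohomological functor with $T^k\langle m\rangle=T^k$ for $k\ge m$, $T^k\langle m\rangle=S^{k-m}T^m$ for $k<m$, and connecting homomorphisms $\delta^k$ for $k\ge m$, $\varepsilon^{k-m}$ for $k<m$. For $m\le m'$ let $\Phi^\bullet_{m,m'}:T^\bullet\langle m\rangle\to T^\bullet\langle m'\rangle$ be the unique morphism of cohomological functors that is the identity in degrees $\ge m'$. Then $\widehat T^\bullet=\varinjlim_{m\in\mathbb N_0}T^\bullet\langle m\rangle$, with connecting homomorphism $\widehat\delta^\bullet$ the direct limit of those of the $T^\bullet\langle m\rangle$; by cofinality $\widehat T^n(M)=\varinjlim_{k\in\mathbb N_0}S^{-k}T^{n+k}(M)$ (indices $k$ large enough that $n+k\ge0$). *)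

theory Defs
  imports "HOL-Algebra.Group" "HOL-Library.Infinite_Typeclass"
begin

section \<open>Abelian categories\<close>

text \<open>
  Zer and Add carry the additive structure of the hom-sets.
  \<open>g \<cdot> f\<close> is the composite of \<open>f\<close> followed by \<open>g\<close>; only composites with Dom g = Cod f matter.
\<close>

record ('o, 'm) ab_cat =
  Ob :: "'o set"
  Arr :: "'m set"
  Dom :: "'m \<Rightarrow> 'o"
  Cod :: "'m \<Rightarrow> 'o"
  Id :: "'o \<Rightarrow> 'm"
  Cmp :: "'m \<Rightarrow> 'm \<Rightarrow> 'm" (infixl "\<cdot>\<index>" 70)
  Zer :: "'o \<Rightarrow> 'o \<Rightarrow> 'm"
  Add :: "'m \<Rightarrow> 'm \<Rightarrow> 'm"

definition homset :: "('o, 'm) ab_cat \<Rightarrow> 'o \<Rightarrow> 'o \<Rightarrow> 'm set" where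
  "homset C a b = {f \<in> Arr C. Dom C f = a \<and> Cod C f = b}"

definition homgroup :: "('o, 'm) ab_cat \<Rightarrow> 'o \<Rightarrow> 'o \<Rightarrow> 'm monoid" where
  "homgroup C a b = \<lparr>carrier = homset C a b, mult = Add C, one = Zer C a b\<rparr>"

locale category =
  fixes C :: "('o, 'm) ab_cat" (structure)
  assumes dom_ob: "f \<in> Arr C \<Longrightarrow> Dom C f \<in> Ob C"
    and cod_ob: "f \<in> Arr C \<Longrightarrow> Cod C f \<in> Ob C"
    and id_hom: "a \<in> Ob C \<Longrightarrow> Id C a \<in> homset C a a"
    and comp_hom: "f \<in> homset C a b \<Longrightarrow> g \<in> homset C b c \<Longrightarrow> g \<cdot> f \<in> homset C a c"
    and comp_id_right: "f \<in> homset C a b \<Longrightarrow> f \<cdot> Id C a = f"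
    and comp_id_left: "f \<in> homset C a b \<Longrightarrow> Id C b \<cdot> f = f"
    and comp_assoc: "f \<in> homset C a b \<Longrightarrow> g \<in> homset C b c \<Longrightarrow> h \<in> homset C c d
      \<Longrightarrow> h \<cdot> (g \<cdot> f) = (h \<cdot> g) \<cdot> f"

locale preadditive_category = category +
  assumes hom_comm_group: "a \<in> Ob C \<Longrightarrow> b \<in> Ob C \<Longrightarrow> comm_group (homgroup C a b)"
    and comp_add_right: "f \<in> homset C a b \<Longrightarrow> f' \<in> homset C a b \<Longrightarrow> g \<in> homset C b c
      \<Longrightarrow> g \<cdot> Add C f f' = Add C (g \<cdot> f) (g \<cdot> f')"
    and comp_add_left: "f \<in> homset C a b \<Longrightarrow> g \<in> homset C b c \<Longrightarrow> g' \<in> homset C b c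
      \<Longrightarrow> Add C g g' \<cdot> f = Add C (g \<cdot> f) (g' \<cdot> f)"

definition is_zero_object :: "('o, 'm) ab_cat \<Rightarrow> 'o \<Rightarrow> bool" where
  "is_zero_object C z \<longleftrightarrow> z \<in> Ob C \<and>
     (\<forall>a\<in>Ob C. (\<exists>!f. f \<in> homset C a z) \<and> (\<exists>!f. f \<in> homset C z a))"

definition is_biproduct :: "('o, 'm) ab_cat \<Rightarrow> 'o \<Rightarrow> 'o \<Rightarrow> 'o \<Rightarrow> 'm \<Rightarrow> 'm \<Rightarrow> 'm \<Rightarrow> 'm \<Rightarrow> bool" where
  "is_biproduct C a b s i j p q \<longleftrightarrow>
     i \<in> homset C a s \<and> j \<in> homset C b s \<and> p \<in> homset C s a \<and> q \<in> homset C s b \<and>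
     p \<cdot>\<^bsub>C\<^esub> i = Id C a \<and> q \<cdot>\<^bsub>C\<^esub> j = Id C b \<and>
     p \<cdot>\<^bsub>C\<^esub> j = Zer C b a \<and> q \<cdot>\<^bsub>C\<^esub> i = Zer C a b \<and>
     Add C (i \<cdot>\<^bsub>C\<^esub> p) (j \<cdot>\<^bsub>C\<^esub> q) = Id C s"

definition mono_arr :: "('o, 'm) ab_cat \<Rightarrow> 'm \<Rightarrow> bool" where
  "mono_arr C m \<longleftrightarrow> m \<in> Arr C \<and>
     (\<forall>a. \<forall>g\<in>homset C a (Dom C m). \<forall>h\<in>homset C a (Dom C m).
        m \<cdot>\<^bsub>C\<^esub> g = m \<cdot>\<^bsub>C\<^esub> h \<longrightarrow> g = h)"

definition epi_arr :: "('o, 'm) ab_cat \<Rightarrow> 'm \<Rightarrow> bool" where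
  "epi_arr C e \<longleftrightarrow> e \<in> Arr C \<and>
     (\<forall>a. \<forall>g\<in>homset C (Cod C e) a. \<forall>h\<in>homset C (Cod C e) a.
        g \<cdot>\<^bsub>C\<^esub> e = h \<cdot>\<^bsub>C\<^esub> e \<longrightarrow> g = h)"

definition is_kernel :: "('o, 'm) ab_cat \<Rightarrow> 'm \<Rightarrow> 'm \<Rightarrow> bool" where
  "is_kernel C f k \<longleftrightarrow> f \<in> Arr C \<and> k \<in> Arr C \<and> Cod C k = Dom C f \<and>
     f \<cdot>\<^bsub>C\<^esub> k = Zer C (Dom C k) (Cod C f) \<and>
     (\<forall>a. \<forall>h\<in>homset C a (Dom C f). f \<cdot>\<^bsub>C\<^esub> h = Zer C a (Cod C f) \<longrightarrow>
        (\<exists>!u. u \<in> homset C a (Dom C k) \<and> k \<cdot>\<^bsub>C\<^esub> u = h))"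

definition is_cokernel :: "('o, 'm) ab_cat \<Rightarrow> 'm \<Rightarrow> 'm \<Rightarrow> bool" where
  "is_cokernel C f q \<longleftrightarrow> f \<in> Arr C \<and> q \<in> Arr C \<and> Dom C q = Cod C f \<and>
     q \<cdot>\<^bsub>C\<^esub> f = Zer C (Dom C f) (Cod C q) \<and>
     (\<forall>a. \<forall>h\<in>homset C (Cod C f) a. h \<cdot>\<^bsub>C\<^esub> f = Zer C (Dom C f) a \<longrightarrow>
        (\<exists>!u. u \<in> homset C (Cod C q) a \<and> u \<cdot>\<^bsub>C\<^esub> q = h))"

locale abelian_category = preadditive_category +
  assumes zero_object: "\<exists>z. is_zero_object C z"
    and biproducts: "a \<in> Ob C \<Longrightarrow> b \<in> Ob C \<Longrightarrow> \<exists>s i j p q. is_biproduct C a b s i j p q"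
    and kernels: "f \<in> Arr C \<Longrightarrow> \<exists>k. is_kernel C f k"
    and cokernels: "f \<in> Arr C \<Longrightarrow> \<exists>q. is_cokernel C f q"
    and mono_normal: "mono_arr C m \<Longrightarrow> \<exists>f. is_kernel C f m"
    and epi_normal: "epi_arr C e \<Longrightarrow> \<exists>f. is_cokernel C f e"

definition short_exact :: "('o, 'm) ab_cat \<Rightarrow> 'm \<Rightarrow> 'm \<Rightarrow> bool" where
  "short_exact C f g \<longleftrightarrow> is_kernel C g f \<and> is_cokernel C f g"

text \<open>The arrow \<open>i\<close> below is the image of \<open>f\<close>, that is, the kernel of its cokernel.\<close>

definition exact_at :: "('o, 'm) ab_cat \<Rightarrow> 'm \<Rightarrow> 'm \<Rightarrow> bool" where
  "exact_at C f g \<longleftrightarrow> (\<exists>q i. is_cokernel C f q \<and> is_kernel C q i \<and> is_kernel C g i)"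

definition projective :: "('o, 'm) ab_cat \<Rightarrow> 'o \<Rightarrow> bool" where
  "projective C P \<longleftrightarrow> P \<in> Ob C \<and>
     (\<forall>e f. epi_arr C e \<and> f \<in> homset C P (Cod C e) \<longrightarrow>
        (\<exists>l\<in>homset C P (Dom C e). e \<cdot>\<^bsub>C\<^esub> l = f))"

definition enough_projectives :: "('o, 'm) ab_cat \<Rightarrow> bool" where
  "enough_projectives C \<longleftrightarrow>
     (\<forall>M\<in>Ob C. \<exists>e. epi_arr C e \<and> Cod C e = M \<and> projective C (Dom C e))"

text \<open>A fixed choice of kernel, given by its inclusion; the kernel object is its domain.\<close>

definition kern :: "('o, 'm) ab_cat \<Rightarrow> 'm \<Rightarrow> 'm" where
  "kern C f = (SOME k. is_kernel C f k)"

text \<open>The factorization of \<open>f\<close> through a monomorphism \<open>i\<close>.\<close>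

definition factor :: "('o, 'm) ab_cat \<Rightarrow> 'm \<Rightarrow> 'm \<Rightarrow> 'm" where
  "factor C i f = (THE u. u \<in> homset C (Dom C f) (Dom C i) \<and> i \<cdot>\<^bsub>C\<^esub> u = f)"

section \<open>Direct limits\<close>

record ('i, 'o, 'm) dsys =
  idx :: "'i set"
  leq :: "'i \<Rightarrow> 'i \<Rightarrow> bool"
  obj :: "'i \<Rightarrow> 'o"
  trn :: "'i \<Rightarrow> 'i \<Rightarrow> 'm"

definition directed_set :: "'i set \<Rightarrow> ('i \<Rightarrow> 'i \<Rightarrow> bool) \<Rightarrow> bool" where
  "directed_set I r \<longleftrightarrow> I \<noteq> {} \<and> (\<forall>i\<in>I. r i i) \<and>
     (\<forall>i\<in>I. \<forall>j\<in>I. \<forall>k\<in>I. r i j \<longrightarrow> r j k \<longrightarrow> r i k) \<and>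
     (\<forall>i\<in>I. \<forall>j\<in>I. \<exists>k\<in>I. r i k \<and> r j k)"

definition direct_system :: "('o, 'm) ab_cat \<Rightarrow> ('i, 'o, 'm) dsys \<Rightarrow> bool" where
  "direct_system D X \<longleftrightarrow> directed_set (idx X) (leq X) \<and>
     (\<forall>i\<in>idx X. obj X i \<in> Ob D \<and> trn X i i = Id D (obj X i)) \<and>
     (\<forall>i\<in>idx X. \<forall>j\<in>idx X. leq X i j \<longrightarrow> trn X i j \<in> homset D (obj X i) (obj X j)) \<and>
     (\<forall>i\<in>idx X. \<forall>j\<in>idx X. \<forall>k\<in>idx X. leq X i j \<longrightarrow> leq X j k \<longrightarrow>
        trn X j k \<cdot>\<^bsub>D\<^esub> trn X i j = trn X i k)"

definition is_cocone ::
  "('o, 'm) ab_cat \<Rightarrow> ('i, 'o, 'm) dsys \<Rightarrow> 'o \<Rightarrow> ('i \<Rightarrow> 'm) \<Rightarrow> bool" where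
  "is_cocone D X L c \<longleftrightarrow> L \<in> Ob D \<and> (\<forall>i\<in>idx X. c i \<in> homset D (obj X i) L) \<and>
     (\<forall>i\<in>idx X. \<forall>j\<in>idx X. leq X i j \<longrightarrow> c j \<cdot>\<^bsub>D\<^esub> trn X i j = c i)"

definition is_direct_limit ::
  "('o, 'm) ab_cat \<Rightarrow> ('i, 'o, 'm) dsys \<Rightarrow> 'o \<Rightarrow> ('i \<Rightarrow> 'm) \<Rightarrow> bool" where
  "is_direct_limit D X L c \<longleftrightarrow> direct_system D X \<and> is_cocone D X L c \<and>
     (\<forall>Z d. is_cocone D X Z d \<longrightarrow>
        (\<exists>!u. u \<in> homset D L Z \<and> (\<forall>i\<in>idx X. u \<cdot>\<^bsub>D\<^esub> c i = d i)))"

definition dsys_morphism ::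
  "('o, 'm) ab_cat \<Rightarrow> ('i, 'o, 'm) dsys \<Rightarrow> ('i, 'o, 'm) dsys \<Rightarrow> ('i \<Rightarrow> 'm) \<Rightarrow> bool" where
  "dsys_morphism D X Y \<phi> \<longleftrightarrow> direct_system D X \<and> direct_system D Y \<and>
     idx X = idx Y \<and> leq X = leq Y \<and>
     (\<forall>i\<in>idx X. \<phi> i \<in> homset D (obj X i) (obj Y i)) \<and>
     (\<forall>i\<in>idx X. \<forall>j\<in>idx X. leq X i j \<longrightarrow>
        trn Y i j \<cdot>\<^bsub>D\<^esub> \<phi> i = \<phi> j \<cdot>\<^bsub>D\<^esub> trn X i j)"

text \<open>
  \<open>u\<close> is the direct limit of the morphism \<open>\<phi>\<close> of direct systems, with respect to the given
  limit cocones; it is the only such arrow, by the universal property of \<open>L\<close>.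
\<close>

definition is_direct_limit_map ::
  "('o, 'm) ab_cat \<Rightarrow> ('i, 'o, 'm) dsys \<Rightarrow> 'o \<Rightarrow> ('i \<Rightarrow> 'm) \<Rightarrow>
    ('i, 'o, 'm) dsys \<Rightarrow> 'o \<Rightarrow> ('i \<Rightarrow> 'm) \<Rightarrow> ('i \<Rightarrow> 'm) \<Rightarrow> 'm \<Rightarrow> bool" where
  "is_direct_limit_map D X L c Y L' c' \<phi> u \<longleftrightarrow>
     is_direct_limit D X L c \<and> is_direct_limit D Y L' c' \<and> dsys_morphism D X Y \<phi> \<and>
     u \<in> homset D L L' \<and> (\<forall>i\<in>idx X. u \<cdot>\<^bsub>D\<^esub> c i = c' i \<cdot>\<^bsub>D\<^esub> \<phi> i)"

text \<open>
  HOL cannot quantify over all directed sets in a formula; the directed sets considered are those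
  whose elements belong to the type \<open>'i\<close>. For infinite \<open>'i\<close> these include all sequential
  limits, up to isomorphism of the index set; for finite \<open>'i\<close> the condition always holds.
\<close>

definition has_exact_direct_limits :: "'i itself \<Rightarrow> ('o, 'm) ab_cat \<Rightarrow> bool" where
  "has_exact_direct_limits (TYPE('i)) D \<longleftrightarrow>
     (\<forall>X :: ('i, 'o, 'm) dsys. direct_system D X \<longrightarrow> (\<exists>L c. is_direct_limit D X L c)) \<and>
     (\<forall>(X :: ('i, 'o, 'm) dsys) L c Y L' c' Z L'' c'' \<phi> \<psi> u v.
        is_direct_limit_map D X L c Y L' c' \<phi> u \<longrightarrow>
        is_direct_limit_map D Y L' c' Z L'' c'' \<psi> v \<longrightarrow>
        (\<forall>i\<in>idx X. short_exact D (\<phi> i) (\<psi> i)) \<longrightarrow> short_exact D u v)"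

definition dlim :: "('o, 'm) ab_cat \<Rightarrow> ('i, 'o, 'm) dsys \<Rightarrow> 'o \<times> ('i \<Rightarrow> 'm)" where
  "dlim D X = (SOME Lc. is_direct_limit D X (fst Lc) (snd Lc))"

definition dlim_map ::
  "('o, 'm) ab_cat \<Rightarrow> ('i, 'o, 'm) dsys \<Rightarrow> ('i, 'o, 'm) dsys \<Rightarrow> ('i \<Rightarrow> 'm) \<Rightarrow> 'm" where
  "dlim_map D X Y \<phi> =
     (THE u. is_direct_limit_map D X (fst (dlim D X)) (snd (dlim D X))
        Y (fst (dlim D Y)) (snd (dlim D Y)) \<phi> u)"

text \<open>The sequential system given by one-step transitions \<open>t k\<close> from \<open>x k\<close> to \<open>x (k + 1)\<close>.\<close>

primrec seq_comp :: "('o, 'm) ab_cat \<Rightarrow> (nat \<Rightarrow> 'o) \<Rightarrow> (nat \<Rightarrow> 'm) \<Rightarrow> nat \<Rightarrow> nat \<Rightarrow> 'm" where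
  "seq_comp D x t k 0 = Id D (x k)"
| "seq_comp D x t k (Suc d) = t (k + d) \<cdot>\<^bsub>D\<^esub> seq_comp D x t k d"

definition seq_system ::
  "('o, 'm) ab_cat \<Rightarrow> nat set \<Rightarrow> (nat \<Rightarrow> 'o) \<Rightarrow> (nat \<Rightarrow> 'm) \<Rightarrow> (nat, 'o, 'm) dsys" where
  "seq_system D I x t =
     \<lparr>idx = I, leq = (\<le>), obj = x, trn = (\<lambda>k l. seq_comp D x t k (l - k))\<rparr>"

section \<open>Cohomological functors\<close>

record ('o1, 'm1, 'o2, 'm2) func =
  fob :: "'o1 \<Rightarrow> 'o2"
  far :: "'m1 \<Rightarrow> 'm2"

definition additive_functor ::
  "('o1, 'm1) ab_cat \<Rightarrow> ('o2, 'm2) ab_cat \<Rightarrow> ('o1, 'm1, 'o2, 'm2) func \<Rightarrow> bool" where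
  "additive_functor C D F \<longleftrightarrow>
     (\<forall>a\<in>Ob C. fob F a \<in> Ob D \<and> far F (Id C a) = Id D (fob F a)) \<and>
     (\<forall>a b. \<forall>f\<in>homset C a b. far F f \<in> homset D (fob F a) (fob F b)) \<and>
     (\<forall>a b c. \<forall>f\<in>homset C a b. \<forall>g\<in>homset C b c.
        far F (g \<cdot>\<^bsub>C\<^esub> f) = far F g \<cdot>\<^bsub>D\<^esub> far F f) \<and>
     (\<forall>a b. \<forall>f\<in>homset C a b. \<forall>g\<in>homset C a b.
        far F (Add C f g) = Add D (far F f) (far F g))"

definition natural_transformation ::
  "('o1, 'm1) ab_cat \<Rightarrow> ('o2, 'm2) ab_cat \<Rightarrow> ('o1, 'm1, 'o2, 'm2) func \<Rightarrow>
    ('o1, 'm1, 'o2, 'm2) func \<Rightarrow> ('o1 \<Rightarrow> 'm2) \<Rightarrow> bool" where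
  "natural_transformation C D F G \<eta> \<longleftrightarrow>
     (\<forall>a\<in>Ob C. \<eta> a \<in> homset D (fob F a) (fob G a)) \<and>
     (\<forall>a b. \<forall>f\<in>homset C a b. \<eta> b \<cdot>\<^bsub>D\<^esub> far F f = far G f \<cdot>\<^bsub>D\<^esub> \<eta> a)"

text \<open>
  \<open>conn T n f g\<close> is the \<open>n\<close>-th connecting homomorphism of the short exact sequence with
  arrows \<open>f : A \<rightarrow> B\<close> and \<open>g : B \<rightarrow> C\<close>.
\<close>

record ('o1, 'm1, 'o2, 'm2) cohfun =
  cfun :: "int \<Rightarrow> ('o1, 'm1, 'o2, 'm2) func"
  conn :: "int \<Rightarrow> 'm1 \<Rightarrow> 'm1 \<Rightarrow> 'm2"

definition cohomological_functor ::
  "('o1, 'm1) ab_cat \<Rightarrow> ('o2, 'm2) ab_cat \<Rightarrow> ('o1, 'm1, 'o2, 'm2) cohfun \<Rightarrow> bool" where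
  "cohomological_functor C D T \<longleftrightarrow>
     (\<forall>n. additive_functor C D (cfun T n)) \<and>
     (\<forall>n f g. short_exact C f g \<longrightarrow>
        conn T n f g \<in> homset D (fob (cfun T n) (Cod C g)) (fob (cfun T (n + 1)) (Dom C f))) \<and>
     (\<forall>n f g f' g' a b c. short_exact C f g \<longrightarrow> short_exact C f' g' \<longrightarrow>
        a \<in> homset C (Dom C f) (Dom C f') \<longrightarrow> b \<in> homset C (Cod C f) (Cod C f') \<longrightarrow>
        c \<in> homset C (Cod C g) (Cod C g') \<longrightarrow>
        b \<cdot>\<^bsub>C\<^esub> f = f' \<cdot>\<^bsub>C\<^esub> a \<longrightarrow> c \<cdot>\<^bsub>C\<^esub> g = g' \<cdot>\<^bsub>C\<^esub> b \<longrightarrow>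
        far (cfun T (n + 1)) a \<cdot>\<^bsub>D\<^esub> conn T n f g = conn T n f' g' \<cdot>\<^bsub>D\<^esub> far (cfun T n) c) \<and>
     (\<forall>n f g. short_exact C f g \<longrightarrow>
        exact_at D (far (cfun T n) f) (far (cfun T n) g) \<and>
        exact_at D (far (cfun T n) g) (conn T n f g) \<and>
        exact_at D (conn T n f g) (far (cfun T (n + 1)) f))"

definition cohfun_morphism ::
  "('o1, 'm1) ab_cat \<Rightarrow> ('o2, 'm2) ab_cat \<Rightarrow> ('o1, 'm1, 'o2, 'm2) cohfun \<Rightarrow>
    ('o1, 'm1, 'o2, 'm2) cohfun \<Rightarrow> (int \<Rightarrow> 'o1 \<Rightarrow> 'm2) \<Rightarrow> bool" where
  "cohfun_morphism C D T U \<Phi> \<longleftrightarrow>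
     (\<forall>n. natural_transformation C D (cfun T n) (cfun U n) (\<Phi> n)) \<and>
     (\<forall>n f g. short_exact C f g \<longrightarrow>
        \<Phi> (n + 1) (Dom C f) \<cdot>\<^bsub>D\<^esub> conn T n f g = conn U n f g \<cdot>\<^bsub>D\<^esub> \<Phi> n (Cod C g))"

section \<open>Left satellites\<close>

text \<open>
  A projective presentation \<open>0 \<rightarrow> K \<rightarrow> P \<rightarrow> M \<rightarrow> 0\<close> is given by its two arrows.
  Throughout, \<open>R\<close> is a choice of a projective presentation \<open>R M\<close> for every object \<open>M\<close>.
\<close>

definition projective_presentation :: "('o, 'm) ab_cat \<Rightarrow> 'o \<Rightarrow> 'm \<times> 'm \<Rightarrow> bool" where
  "projective_presentation C M r \<longleftrightarrow>
     short_exact C (fst r) (snd r) \<and> Cod C (snd r) = M \<and> projective C (Dom C (snd r))"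

text \<open>\<open>lift_arr C p g\<close> is some arrow \<open>l\<close> with \<open>g \<cdot> l = p\<close>.\<close>

definition lift_arr :: "('o, 'm) ab_cat \<Rightarrow> 'm \<Rightarrow> 'm \<Rightarrow> 'm" where
  "lift_arr C p g = (SOME l. l \<in> homset C (Dom C p) (Dom C g) \<and> g \<cdot>\<^bsub>C\<^esub> l = p)"

definition sat_incl ::
  "('o1, 'm1) ab_cat \<Rightarrow> ('o2, 'm2) ab_cat \<Rightarrow> ('o1 \<Rightarrow> 'm1 \<times> 'm1) \<Rightarrow>
    ('o1, 'm1, 'o2, 'm2) func \<Rightarrow> 'o1 \<Rightarrow> 'm2" where
  "sat_incl C D R F M = kern D (far F (fst (R M)))"

text \<open>
  For \<open>a : M' \<rightarrow> M\<close>, the arrow \<open>P' \<rightarrow> P\<close> lifts the composite \<open>P' \<rightarrow> M' \<rightarrow> M\<close>, and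
  \<open>syz_map C R a : K' \<rightarrow> K\<close> is its restriction.
\<close>

definition syz_map :: "('o1, 'm1) ab_cat \<Rightarrow> ('o1 \<Rightarrow> 'm1 \<times> 'm1) \<Rightarrow> 'm1 \<Rightarrow> 'm1" where
  "syz_map C R a =
     (let r' = R (Dom C a); r = R (Cod C a); l = lift_arr C (a \<cdot>\<^bsub>C\<^esub> snd r') (snd r)
      in factor C (fst r) (l \<cdot>\<^bsub>C\<^esub> fst r'))"

definition sat1 ::
  "('o1, 'm1) ab_cat \<Rightarrow> ('o2, 'm2) ab_cat \<Rightarrow> ('o1 \<Rightarrow> 'm1 \<times> 'm1) \<Rightarrow>
    ('o1, 'm1, 'o2, 'm2) func \<Rightarrow> ('o1, 'm1, 'o2, 'm2) func" where
  "sat1 C D R F =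
     \<lparr>fob = (\<lambda>M. Dom D (sat_incl C D R F M)),
      far = (\<lambda>a. factor D (sat_incl C D R F (Cod C a))
               (far F (syz_map C R a) \<cdot>\<^bsub>D\<^esub> sat_incl C D R F (Dom C a)))\<rparr>"

definition sat1_nat ::
  "('o1, 'm1) ab_cat \<Rightarrow> ('o2, 'm2) ab_cat \<Rightarrow> ('o1 \<Rightarrow> 'm1 \<times> 'm1) \<Rightarrow>
    ('o1, 'm1, 'o2, 'm2) func \<Rightarrow> ('o1, 'm1, 'o2, 'm2) func \<Rightarrow> ('o1 \<Rightarrow> 'm2) \<Rightarrow> 'o1 \<Rightarrow> 'm2" where
  "sat1_nat C D R F G \<phi> M =
     factor D (sat_incl C D R G M) (\<phi> (Dom C (fst (R M))) \<cdot>\<^bsub>D\<^esub> sat_incl C D R F M)"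

text \<open>\<open>sat C D R k F\<close> is \<open>S\<close> to the power \<open>-k\<close> of \<open>F\<close>; similarly for natural transformations.\<close>

primrec sat ::
  "('o1, 'm1) ab_cat \<Rightarrow> ('o2, 'm2) ab_cat \<Rightarrow> ('o1 \<Rightarrow> 'm1 \<times> 'm1) \<Rightarrow> nat \<Rightarrow>
    ('o1, 'm1, 'o2, 'm2) func \<Rightarrow> ('o1, 'm1, 'o2, 'm2) func" where
  "sat C D R 0 F = F"
| "sat C D R (Suc k) F = sat1 C D R (sat C D R k F)"

primrec sat_nat ::
  "('o1, 'm1) ab_cat \<Rightarrow> ('o2, 'm2) ab_cat \<Rightarrow> ('o1 \<Rightarrow> 'm1 \<times> 'm1) \<Rightarrow> nat \<Rightarrow>
    ('o1, 'm1, 'o2, 'm2) func \<Rightarrow> ('o1, 'm1, 'o2, 'm2) func \<Rightarrow> ('o1 \<Rightarrow> 'm2) \<Rightarrow> 'o1 \<Rightarrow> 'm2" where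
  "sat_nat C D R 0 F G \<phi> = \<phi>"
| "sat_nat C D R (Suc k) F G \<phi> =
     sat1_nat C D R (sat C D R k F) (sat C D R k G) (sat_nat C D R k F G \<phi>)"

text \<open>
  For \<open>k \<ge> 1\<close>, \<open>sat_conn C D R F k f g\<close> is the connecting homomorphism \<open>\<epsilon>\<close> of index \<open>-k\<close>, from
  the \<open>k\<close>-th satellite of \<open>F\<close> at Cod g to the \<open>(k - 1)\<close>-th one at Dom f.
\<close>

definition sat_conn ::
  "('o1, 'm1) ab_cat \<Rightarrow> ('o2, 'm2) ab_cat \<Rightarrow> ('o1 \<Rightarrow> 'm1 \<times> 'm1) \<Rightarrow>
    ('o1, 'm1, 'o2, 'm2) func \<Rightarrow> nat \<Rightarrow> 'm1 \<Rightarrow> 'm1 \<Rightarrow> 'm2" where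
  "sat_conn C D R F k f g =
     (let r = R (Cod C g); h = lift_arr C (snd r) g; h' = factor C f (h \<cdot>\<^bsub>C\<^esub> fst r)
      in far (sat C D R (k - 1) F) h' \<cdot>\<^bsub>D\<^esub> sat_incl C D R (sat C D R (k - 1) F) (Cod C g))"

text \<open>The factorization of the connecting homomorphism of \<open>R M\<close> through the satellite.\<close>

definition delta_under ::
  "('o1, 'm1) ab_cat \<Rightarrow> ('o2, 'm2) ab_cat \<Rightarrow> ('o1 \<Rightarrow> 'm1 \<times> 'm1) \<Rightarrow>
    ('o1, 'm1, 'o2, 'm2) cohfun \<Rightarrow> int \<Rightarrow> 'o1 \<Rightarrow> 'm2" where
  "delta_under C D R T n M =
     factor D (sat_incl C D R (cfun T (n + 1)) M) (conn T n (fst (R M)) (snd (R M)))"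

section \<open>The satellite functor construction\<close>

definition sat_trunc ::
  "('o1, 'm1) ab_cat \<Rightarrow> ('o2, 'm2) ab_cat \<Rightarrow> ('o1 \<Rightarrow> 'm1 \<times> 'm1) \<Rightarrow>
    ('o1, 'm1, 'o2, 'm2) cohfun \<Rightarrow> nat \<Rightarrow> ('o1, 'm1, 'o2, 'm2) cohfun" where
  "sat_trunc C D R T m =
     \<lparr>cfun = (\<lambda>k. if k \<ge> int m then cfun T k
                  else sat C D R (nat (int m - k)) (cfun T (int m))),
      conn = (\<lambda>k f g. if k \<ge> int m then conn T k f g
                  else sat_conn C D R (cfun T (int m)) (nat (int m - k)) f g)\<rparr>"

text \<open>
  The conditions determine the components at the objects of \<open>C\<close>, and only these are used;
  the values at other elements of the type of objects are arbitrary.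
\<close>

definition sat_trans ::
  "('o1, 'm1) ab_cat \<Rightarrow> ('o2, 'm2) ab_cat \<Rightarrow> ('o1 \<Rightarrow> 'm1 \<times> 'm1) \<Rightarrow>
    ('o1, 'm1, 'o2, 'm2) cohfun \<Rightarrow> nat \<Rightarrow> nat \<Rightarrow> int \<Rightarrow> 'o1 \<Rightarrow> 'm2" where
  "sat_trans C D R T m m' =
     (SOME \<Phi>. cohfun_morphism C D (sat_trunc C D R T m) (sat_trunc C D R T m') \<Phi> \<and>
        (\<forall>k\<ge>int m'. \<forall>M\<in>Ob C. \<Phi> k M = Id D (fob (cfun T k) M)))"

definition hat_system ::
  "('o1, 'm1) ab_cat \<Rightarrow> ('o2, 'm2) ab_cat \<Rightarrow> ('o1 \<Rightarrow> 'm1 \<times> 'm1) \<Rightarrow>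
    ('o1, 'm1, 'o2, 'm2) cohfun \<Rightarrow> int \<Rightarrow> 'o1 \<Rightarrow> (nat, 'o2, 'm2) dsys" where
  "hat_system C D R T n M =
     \<lparr>idx = UNIV, leq = (\<le>), obj = (\<lambda>m. fob (cfun (sat_trunc C D R T m) n) M),
      trn = (\<lambda>m m'. sat_trans C D R T m m' n M)\<rparr>"

definition hat_cohfun ::
  "('o1, 'm1) ab_cat \<Rightarrow> ('o2, 'm2) ab_cat \<Rightarrow> ('o1 \<Rightarrow> 'm1 \<times> 'm1) \<Rightarrow>
    ('o1, 'm1, 'o2, 'm2) cohfun \<Rightarrow> ('o1, 'm1, 'o2, 'm2) cohfun" where
  "hat_cohfun C D R T =
     \<lparr>cfun = (\<lambda>n.
        \<lparr>fob = (\<lambda>M. fst (dlim D (hat_system C D R T n M))),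
         far = (\<lambda>a. dlim_map D (hat_system C D R T n (Dom C a)) (hat_system C D R T n (Cod C a))
                  (\<lambda>m. far (cfun (sat_trunc C D R T m) n) a))\<rparr>),
      conn = (\<lambda>n f g.
        dlim_map D (hat_system C D R T n (Cod C g)) (hat_system C D R T (n + 1) (Dom C f))
          (\<lambda>m. conn (sat_trunc C D R T m) n f g))\<rparr>"

text \<open>The canonical arrow from the \<open>m\<close>-th term of the system into its direct limit.\<close>

definition hat_leg ::
  "('o1, 'm1) ab_cat \<Rightarrow> ('o2, 'm2) ab_cat \<Rightarrow> ('o1 \<Rightarrow> 'm1 \<times> 'm1) \<Rightarrow>
    ('o1, 'm1, 'o2, 'm2) cohfun \<Rightarrow> int \<Rightarrow> 'o1 \<Rightarrow> nat \<Rightarrow> 'm2" where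
  "hat_leg C D R T n M m = snd (dlim D (hat_system C D R T n M)) m"

text \<open>
  The system of the satellites \<open>S\<^sup>-\<^sup>k T\<^sup>n\<^sup>+\<^sup>k(M)\<close> over \<open>k \<ge> 1\<close> and that of the
  \<open>S\<^sup>-\<^sup>k\<^sup>+\<^sup>1 T\<^sup>n\<^sup>+\<^sup>k(M)\<close>, whose transitions are the satellites of \<open>delta_under\<close>.
\<close>

definition conn_source_system ::
  "('o1, 'm1) ab_cat \<Rightarrow> ('o2, 'm2) ab_cat \<Rightarrow> ('o1 \<Rightarrow> 'm1 \<times> 'm1) \<Rightarrow>
    ('o1, 'm1, 'o2, 'm2) cohfun \<Rightarrow> int \<Rightarrow> 'o1 \<Rightarrow> (nat, 'o2, 'm2) dsys" where
  "conn_source_system C D R T n M =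
     seq_system D {1..}
       (\<lambda>k. fob (sat C D R k (cfun T (n + int k))) M)
       (\<lambda>k. sat_nat C D R k (cfun T (n + int k)) (sat1 C D R (cfun T (n + int k + 1)))
              (delta_under C D R T (n + int k)) M)"

definition conn_target_system ::
  "('o1, 'm1) ab_cat \<Rightarrow> ('o2, 'm2) ab_cat \<Rightarrow> ('o1 \<Rightarrow> 'm1 \<times> 'm1) \<Rightarrow>
    ('o1, 'm1, 'o2, 'm2) cohfun \<Rightarrow> int \<Rightarrow> 'o1 \<Rightarrow> (nat, 'o2, 'm2) dsys" where
  "conn_target_system C D R T n M =
     seq_system D {1..}
       (\<lambda>k. fob (sat C D R (k - 1) (cfun T (n + int k))) M)
       (\<lambda>k. sat_nat C D R (k - 1) (cfun T (n + int k)) (sat1 C D R (cfun T (n + int k + 1)))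
              (delta_under C D R T (n + int k)) M)"

end

theory Submission
  imports Defs
begin

text \<open>
  On the kernel defining a left satellite, a functor does not see the choice of lifts, since
  the maps of syzygies they induce differ by a map through a projective cover. Hence satellites are functors, their connecting
  homomorphisms \<open>\<epsilon>\<close> are natural in the functor, and \<open>\<delta>\<close> factors as \<open>\<epsilon>\<close> after
  \<open>delta_under\<close>. So the satellites of \<open>delta_under\<close>, continued by identities in high
  degrees, form a morphism from \<open>T\<langle>m\<rangle>\<close> to \<open>T\<langle>m + 1\<rangle>\<close>. A morphism
  into \<open>T\<langle>m'\<rangle>\<close> is determined by its high degrees, because \<open>\<epsilon>\<close> of a
  projective presentation is the kernel inclusion, a monomorphism. This identifies the
  transitions defining the limit with satellites of \<open>delta_under\<close>, and the system of the
  \<open>\<epsilon>\<close> is, up to finitely many initial terms, a tail of the one defining the limit.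
\<close>

section \<open>Preadditive categories\<close>

text \<open>Chosen syzygy maps need not be functorial: the lift chosen for a composite need not be
  the composite of lifts. The computations therefore use the relation \<open>comparison\<close>,
  which is closed under identities, composition and sums, and cancel a kernel inclusion at the end.
  Two conventions have to be reconciled. \<open>sat\<close> adds a satellite on the outside, while a
  satellite of \<open>delta_under\<close> ends in one added on the inside; as the choice
  \<open>R\<close> is fixed, both orders give equal functors, and degrees can be shifted without
  isomorphisms. Further, the limit is indexed by \<open>m \<ge> 0\<close>, the system of satellites
  by \<open>k \<ge> 1\<close>, with \<open>m = n + k\<close>. For negative \<open>n\<close> its
  first terms come from negative degrees of \<open>T\<close> and correspond to no term of the limit
  system; their legs are produced by composing transitions, and their squares follow by passing to a
  later index.\<close>

lemma homsetD:
  assumes "f \<in> homset C a b"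
  shows "f \<in> Arr C" "Dom C f = a" "Cod C f = b"
  using assms by (auto simp: homset_def)

context category
begin

lemma hom_ob:
  assumes "f \<in> homset C a b"
  shows "a \<in> Ob C" "b \<in> Ob C"
  using assms dom_ob cod_ob by (auto simp: homset_def)

text \<open>Replacing one side of a commuting square inside a longer composite is the basic move of
  the later diagram chases; this form hides the two reassociations.\<close>

lemma comp_square:
  assumes "f \<in> homset C a b" "g \<in> homset C b d" "f' \<in> homset C a b'" "g' \<in> homset C b' d"
    and "g \<cdot> f = g' \<cdot> f'" and "e \<in> homset C z a"
  shows "g \<cdot> (f \<cdot> e) = g' \<cdot> (f' \<cdot> e)"
  using comp_assoc[OF assms(6,1,2)] comp_assoc[OF assms(6,3,4)] assms(5) by simp

end

context preadditive_category
begin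

lemma zero_hom: "a \<in> Ob C \<Longrightarrow> b \<in> Ob C \<Longrightarrow> Zer C a b \<in> homset C a b"
  using monoid.one_closed[of "homgroup C a b"] hom_comm_group[of a b]
  by (simp add: comm_group_def group_def homgroup_def)

lemma add_hom:
  assumes "f \<in> homset C a b" "g \<in> homset C a b"
  shows "Add C f g \<in> homset C a b"
proof -
  interpret comm_group "homgroup C a b" using hom_comm_group hom_ob assms by metis
  show ?thesis using m_closed[of f g] assms by (simp add: homgroup_def)
qed

lemma add_zero_right:
  assumes "f \<in> homset C a b"
  shows "Add C f (Zer C a b) = f"
proof -
  interpret comm_group "homgroup C a b" using hom_comm_group hom_ob assms by metis
  show ?thesis using r_one[of f] assms by (simp add: homgroup_def)
qed

lemma add_left_cancel:
  assumes "f \<in> homset C a b" "g \<in> homset C a b" "h \<in> homset C a b"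
    and "Add C f g = Add C f h"
  shows "g = h"
proof -
  interpret comm_group "homgroup C a b" using hom_comm_group hom_ob assms by metis
  show ?thesis using Units_l_cancel[of f g h] Units_eq assms by (simp add: homgroup_def)
qed

text \<open>\<open>ab_cat\<close> has an addition but no negation of arrows, so subtraction enters
  only as the existence of a difference, taken from the inverse in the hom-group.\<close>

lemma difference_exists:
  assumes "f \<in> homset C a b" "g \<in> homset C a b"
  obtains d where "d \<in> homset C a b" "f = Add C g d"
proof -
  interpret comm_group "homgroup C a b" using hom_comm_group hom_ob assms by metis
  let ?G = "homgroup C a b"
  have f: "f \<in> carrier ?G" and g: "g \<in> carrier ?G" using assms by (simp_all add: homgroup_def)
  have d: "inv\<^bsub>?G\<^esub> g \<otimes>\<^bsub>?G\<^esub> f \<in> carrier ?G" using f g by simp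
  have "f = g \<otimes>\<^bsub>?G\<^esub> (inv\<^bsub>?G\<^esub> g \<otimes>\<^bsub>?G\<^esub> f)"
    using f g by (simp add: m_assoc[symmetric])
  with d show thesis by (intro that) (simp_all add: homgroup_def)
qed

text \<open>An idempotent of a group is its identity; this is how composites with zero arrows are
  shown to vanish.\<close>

lemma add_idem_zero:
  assumes "f \<in> homset C a b" "Add C f f = f"
  shows "f = Zer C a b"
  using add_left_cancel[of f a b f "Zer C a b"] assms zero_hom hom_ob add_zero_right by metis

lemma comp_zero_right:
  assumes "g \<in> homset C b c" "a \<in> Ob C"
  shows "g \<cdot> Zer C a b = Zer C a c"
proof (rule add_idem_zero)
  have z: "Zer C a b \<in> homset C a b" using assms zero_hom hom_ob by blast
  show "g \<cdot> Zer C a b \<in> homset C a c" using comp_hom[OF z] assms by blast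
  show "Add C (g \<cdot> Zer C a b) (g \<cdot> Zer C a b) = g \<cdot> Zer C a b"
    using comp_add_right[OF z z assms(1)] add_zero_right[OF z] by simp
qed

lemma comp_zero_left:
  assumes "f \<in> homset C a b" "c \<in> Ob C"
  shows "Zer C b c \<cdot> f = Zer C a c"
proof (rule add_idem_zero)
  have z: "Zer C b c \<in> homset C b c" using assms zero_hom hom_ob by blast
  show "Zer C b c \<cdot> f \<in> homset C a c" using comp_hom[OF assms(1) z] .
  show "Add C (Zer C b c \<cdot> f) (Zer C b c \<cdot> f) = Zer C b c \<cdot> f"
    using comp_add_left[OF assms(1) z z] add_zero_right[OF z] by simp
qed

section \<open>Kernels, cokernels and exactness\<close>

lemma is_kernel_hom:
  assumes "is_kernel C f k"
  shows "f \<in> homset C (Dom C f) (Cod C f)" "k \<in> homset C (Dom C k) (Dom C f)"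
    "f \<cdot> k = Zer C (Dom C k) (Cod C f)"
  using assms by (auto simp: is_kernel_def homset_def)

lemma is_kernel_mono:
  assumes "is_kernel C f k" "u \<in> homset C a (Dom C k)" "v \<in> homset C a (Dom C k)"
    and "k \<cdot> u = k \<cdot> v"
  shows "u = v"
proof -
  note k = is_kernel_hom[OF assms(1)]
  have "f \<cdot> (k \<cdot> u) = Zer C a (Cod C f)"
    using comp_assoc[OF assms(2) k(2,1)] k(3) comp_zero_left[OF assms(2), of "Cod C f"] hom_ob k(1)
    by metis
  moreover have "k \<cdot> u \<in> homset C a (Dom C f)" using comp_hom assms(2) k by blast
  ultimately have "\<exists>!w. w \<in> homset C a (Dom C k) \<and> k \<cdot> w = k \<cdot> u"
    using assms(1) unfolding is_kernel_def by blast
  with assms show ?thesis by metis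
qed

lemma factor_kernel:
  assumes "is_kernel C f k" "h \<in> homset C a (Dom C f)" "f \<cdot> h = Zer C a (Cod C f)"
  shows "factor C k h \<in> homset C a (Dom C k)" "k \<cdot> factor C k h = h"
proof -
  have "\<exists>!u. u \<in> homset C a (Dom C k) \<and> k \<cdot> u = h"
    using assms unfolding is_kernel_def by blast
  from theI'[OF this] show "factor C k h \<in> homset C a (Dom C k)" "k \<cdot> factor C k h = h"
    using homsetD(2)[OF assms(2)] by (simp_all add: factor_def)
qed

lemma is_cokernel_epi:
  assumes "is_cokernel C f q"
  shows "epi_arr C q"
  unfolding epi_arr_def
proof (intro conjI allI ballI impI)
  show q: "q \<in> Arr C" using assms by (simp add: is_cokernel_def)
  fix a g h
  assume g: "g \<in> homset C (Cod C q) a" and h: "h \<in> homset C (Cod C q) a" and eq: "g \<cdot> q = h \<cdot> q"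
  have q: "q \<in> homset C (Cod C f) (Cod C q)" and f: "f \<in> homset C (Dom C f) (Cod C f)"
    and qf: "q \<cdot> f = Zer C (Dom C f) (Cod C q)"
    using assms by (auto simp: is_cokernel_def homset_def)
  have "(g \<cdot> q) \<cdot> f = Zer C (Dom C f) a"
    using comp_assoc[OF f q g] qf comp_zero_right[OF g] hom_ob f by metis
  moreover have "g \<cdot> q \<in> homset C (Cod C f) a" using comp_hom q g by blast
  ultimately have "\<exists>!u. u \<in> homset C (Cod C q) a \<and> u \<cdot> q = g \<cdot> q"
    using assms unfolding is_cokernel_def by blast
  with g h eq show "g = h" by metis
qed

text \<open>The arrow \<open>f\<close> factors through its image because its cokernel kills it, and
  exactness says that this image is a kernel of \<open>g\<close>.\<close>

lemma exact_at_comp_zero: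
  assumes "exact_at C f g"
  shows "g \<cdot> f = Zer C (Dom C f) (Cod C g)"
proof -
  obtain q i where q: "is_cokernel C f q" and qi: "is_kernel C q i" and gi: "is_kernel C g i"
    using assms unfolding exact_at_def by blast
  note i = is_kernel_hom[OF gi]
  have f: "f \<in> homset C (Dom C f) (Dom C q)" "q \<cdot> f = Zer C (Dom C f) (Cod C q)"
    using q by (auto simp: is_cokernel_def homset_def)
  have "Dom C q = Dom C g" using qi gi by (simp add: is_kernel_def)
  note u = factor_kernel[OF qi f]
  have "g \<cdot> f = (g \<cdot> i) \<cdot> factor C i f"
    using comp_assoc[OF u(1) i(2,1)] u(2) by simp
  also have "\<dots> = Zer C (Dom C f) (Cod C g)"
    using i comp_zero_left[OF u(1)] hom_ob by metis
  finally show ?thesis .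
qed

lemma short_exact_hom:
  assumes "short_exact C f g"
  shows "f \<in> homset C (Dom C f) (Cod C f)" "g \<in> homset C (Cod C f) (Cod C g)"
    "Dom C g = Cod C f"
    "is_kernel C g f" "epi_arr C g"
  using assms is_cokernel_epi by (auto simp: short_exact_def is_kernel_def homset_def)

end

section \<open>Comparison maps\<close>

text \<open>
  A pair \<open>r\<close> stands for the sequence with arrows \<open>fst r\<close> and \<open>snd r\<close>; \<open>h\<close> is a map of left
  ends induced by some map of middle terms over the map \<open>a\<close> of right ends.
\<close>

definition comparison ::
  "('o, 'm) ab_cat \<Rightarrow> 'm \<times> 'm \<Rightarrow> 'm \<Rightarrow> 'm \<times> 'm \<Rightarrow> 'm \<Rightarrow> bool" where
  "comparison C r a r' h \<longleftrightarrow> h \<in> homset C (Dom C (fst r)) (Dom C (fst r')) \<and>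
     (\<exists>l\<in>homset C (Cod C (fst r)) (Cod C (fst r')).
        snd r' \<cdot>\<^bsub>C\<^esub> l = a \<cdot>\<^bsub>C\<^esub> snd r \<and> fst r' \<cdot>\<^bsub>C\<^esub> h = l \<cdot>\<^bsub>C\<^esub> fst r)"

abbreviation short_exact_pair :: "('o, 'm) ab_cat \<Rightarrow> 'm \<times> 'm \<Rightarrow> bool" where
  "short_exact_pair C r \<equiv> short_exact C (fst r) (snd r)"

context preadditive_category
begin

text \<open>Projectivity gives the lift, and it carries the left end into the kernel because
  \<open>snd r\<close> kills \<open>fst r\<close>. The witness is spelled out since
  \<open>syz_map\<close> and \<open>sat_conn\<close> are defined by terms of this shape.\<close>

lemma comparison_exists:
  assumes r: "short_exact_pair C r" and P: "projective C (Dom C (snd r))"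
    and r': "short_exact_pair C r'" and a: "a \<in> homset C (Cod C (snd r)) (Cod C (snd r'))"
  shows "comparison C r a r'
    (factor C (fst r') (lift_arr C (a \<cdot> snd r) (snd r') \<cdot> fst r))"
proof -
  note e = short_exact_hom[OF r] and e' = short_exact_hom[OF r']
  have ap: "a \<cdot> snd r \<in> homset C (Cod C (fst r)) (Cod C (snd r'))" using comp_hom[OF e(2) a] .
  let ?l = "lift_arr C (a \<cdot> snd r) (snd r')"
  have "\<exists>l. l \<in> homset C (Dom C (a \<cdot> snd r)) (Dom C (snd r')) \<and> snd r' \<cdot> l = a \<cdot> snd r"
    using P e'(5) ap e(3) homsetD[OF ap] unfolding projective_def by auto
  from someI_ex[OF this] have l: "?l \<in> homset C (Cod C (fst r)) (Cod C (fst r'))"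
    "snd r' \<cdot> ?l = a \<cdot> snd r"
    using homsetD[OF ap] e'(3) by (simp_all add: lift_arr_def)
  have lf: "?l \<cdot> fst r \<in> homset C (Dom C (fst r)) (Dom C (snd r'))"
    using comp_hom[OF e(1) l(1)] e'(3) by simp
  have "snd r' \<cdot> (?l \<cdot> fst r) = (a \<cdot> snd r) \<cdot> fst r"
    using comp_assoc[OF e(1) l(1) e'(2)] l(2) by simp
  also have "\<dots> = a \<cdot> Zer C (Dom C (fst r)) (Cod C (snd r))"
    using comp_assoc[OF e(1,2) a] is_kernel_hom(3)[OF e(4)] by simp
  also have "\<dots> = Zer C (Dom C (fst r)) (Cod C (snd r'))"
    using comp_zero_right[OF a] hom_ob[OF e(1)] by blast
  finally show ?thesis
    using factor_kernel[OF e'(4) lf] l by (auto simp: comparison_def)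
qed

lemma comparison_homotopic:
  assumes r: "short_exact_pair C r" and r': "short_exact_pair C r'"
    and h: "comparison C r a r' h" and h': "comparison C r a r' h'"
  obtains s where "s \<in> homset C (Cod C (fst r)) (Dom C (fst r'))" "h' = Add C h (s \<cdot> fst r)"
proof -
  note e = short_exact_hom[OF r] and e' = short_exact_hom[OF r']
  obtain l l' where l: "l \<in> homset C (Cod C (fst r)) (Cod C (fst r'))"
      "snd r' \<cdot> l = a \<cdot> snd r" "fst r' \<cdot> h = l \<cdot> fst r"
    and l': "l' \<in> homset C (Cod C (fst r)) (Cod C (fst r'))"
      "snd r' \<cdot> l' = a \<cdot> snd r" "fst r' \<cdot> h' = l' \<cdot> fst r"
    using h h' unfolding comparison_def by blast
  have hh: "h \<in> homset C (Dom C (fst r)) (Dom C (fst r'))"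
    "h' \<in> homset C (Dom C (fst r)) (Dom C (fst r'))"
    using h h' unfolding comparison_def by blast+
  \<comment> \<open>The difference of the two middle maps is killed by \<open>snd r'\<close>, hence
    factors through its kernel \<open>fst r'\<close>; that factor is the homotopy
    \<open>s\<close>.\<close>
  obtain d where d: "d \<in> homset C (Cod C (fst r)) (Cod C (fst r'))" "l' = Add C l d"
    using difference_exists[OF l'(1) l(1)] .
  have gl: "snd r' \<cdot> l \<in> homset C (Cod C (fst r)) (Cod C (snd r'))"
    "snd r' \<cdot> d \<in> homset C (Cod C (fst r)) (Cod C (snd r'))"
    using comp_hom e'(2) l(1) d(1) by blast+
  have z: "Zer C (Cod C (fst r)) (Cod C (snd r')) \<in> homset C (Cod C (fst r)) (Cod C (snd r'))"
    using zero_hom hom_ob gl(1) by blast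
  have "Add C (snd r' \<cdot> l) (snd r' \<cdot> d) = Add C (snd r' \<cdot> l) (Zer C (Cod C (fst r)) (Cod C (snd r')))"
    using comp_add_right[OF l(1) d(1) e'(2)] add_zero_right[OF gl(1)] l l' d by simp
  then have "snd r' \<cdot> d = Zer C (Cod C (fst r)) (Cod C (snd r'))"
    using add_left_cancel[OF gl z] by blast
  then obtain s where s: "s \<in> homset C (Cod C (fst r)) (Dom C (fst r'))" "fst r' \<cdot> s = d"
    using factor_kernel[OF e'(4)] d(1) e'(3) by metis
  have si: "s \<cdot> fst r \<in> homset C (Dom C (fst r)) (Dom C (fst r'))" using comp_hom[OF e(1) s(1)] .
  have "fst r' \<cdot> Add C h (s \<cdot> fst r) = Add C (l \<cdot> fst r) (d \<cdot> fst r)"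
    using comp_add_right[OF hh(1) si e'(1)] l(3) comp_assoc[OF e(1) s(1) e'(1)] s(2) by simp
  also have "\<dots> = fst r' \<cdot> h'"
    using comp_add_left[OF e(1) l(1) d(1)] d(2) l'(3) by simp
  finally have "h' = Add C h (s \<cdot> fst r)"
    using is_kernel_mono[OF e'(4) hh(2) add_hom[OF hh(1) si]] by simp
  with s(1) that show thesis by blast
qed

lemma comparison_id:
  assumes "short_exact_pair C r"
  shows "comparison C r (Id C (Cod C (snd r))) r (Id C (Dom C (fst r)))"
proof -
  note e = short_exact_hom[OF assms]
  show ?thesis
    unfolding comparison_def
    using id_hom[OF hom_ob(1)[OF e(1)]] id_hom[OF hom_ob(2)[OF e(1)]]
      comp_id_left[OF e(1)] comp_id_left[OF e(2)] comp_id_right[OF e(1)] comp_id_right[OF e(2)]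
    by auto
qed

lemma comparison_comp:
  assumes r: "short_exact_pair C r" and r': "short_exact_pair C r'" and r'': "short_exact_pair C r''"
    and a: "a \<in> homset C (Cod C (snd r)) (Cod C (snd r'))"
    and a': "a' \<in> homset C (Cod C (snd r')) (Cod C (snd r''))"
    and h: "comparison C r a r' h" and h': "comparison C r' a' r'' h'"
  shows "comparison C r (a' \<cdot> a) r'' (h' \<cdot> h)"
proof -
  note e = short_exact_hom[OF r] and e' = short_exact_hom[OF r'] and e'' = short_exact_hom[OF r'']
  obtain l l' where l: "l \<in> homset C (Cod C (fst r)) (Cod C (fst r'))"
      "snd r' \<cdot> l = a \<cdot> snd r" "fst r' \<cdot> h = l \<cdot> fst r"
    and l': "l' \<in> homset C (Cod C (fst r')) (Cod C (fst r''))"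
      "snd r'' \<cdot> l' = a' \<cdot> snd r'" "fst r'' \<cdot> h' = l' \<cdot> fst r'"
    using h h' unfolding comparison_def by blast
  have hh: "h \<in> homset C (Dom C (fst r)) (Dom C (fst r'))"
    "h' \<in> homset C (Dom C (fst r')) (Dom C (fst r''))"
    using h h' unfolding comparison_def by blast+
  have "snd r'' \<cdot> (l' \<cdot> l) = (a' \<cdot> a) \<cdot> snd r"
    using comp_assoc[OF l(1) l'(1) e''(2)] comp_assoc[OF l(1) e'(2) a'] comp_assoc[OF e(2) a a'] l l'
    by simp
  moreover have "fst r'' \<cdot> (h' \<cdot> h) = (l' \<cdot> l) \<cdot> fst r"
    using comp_assoc[OF hh e''(1)] comp_assoc[OF hh(1) e'(1) l'(1)] comp_assoc[OF e(1) l(1) l'(1)] l l'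
    by simp
  ultimately show ?thesis
    unfolding comparison_def using comp_hom[OF hh] comp_hom[OF l(1) l'(1)] by blast
qed

lemma comparison_add:
  assumes r: "short_exact_pair C r" and r': "short_exact_pair C r'"
    and a: "a \<in> homset C (Cod C (snd r)) (Cod C (snd r'))"
    and a': "a' \<in> homset C (Cod C (snd r)) (Cod C (snd r'))"
    and h: "comparison C r a r' h" and h': "comparison C r a' r' h'"
  shows "comparison C r (Add C a a') r' (Add C h h')"
proof -
  note e = short_exact_hom[OF r] and e' = short_exact_hom[OF r']
  obtain l l' where l: "l \<in> homset C (Cod C (fst r)) (Cod C (fst r'))"
      "snd r' \<cdot> l = a \<cdot> snd r" "fst r' \<cdot> h = l \<cdot> fst r"
    and l': "l' \<in> homset C (Cod C (fst r)) (Cod C (fst r'))"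
      "snd r' \<cdot> l' = a' \<cdot> snd r" "fst r' \<cdot> h' = l' \<cdot> fst r"
    using h h' unfolding comparison_def by blast
  have hh: "h \<in> homset C (Dom C (fst r)) (Dom C (fst r'))"
    "h' \<in> homset C (Dom C (fst r)) (Dom C (fst r'))"
    using h h' unfolding comparison_def by blast+
  have "snd r' \<cdot> Add C l l' = Add C a a' \<cdot> snd r"
    using comp_add_right[OF l(1) l'(1) e'(2)] comp_add_left[OF e(2) a a'] l l' by simp
  moreover have "fst r' \<cdot> Add C h h' = Add C l l' \<cdot> fst r"
    using comp_add_right[OF hh e'(1)] comp_add_left[OF e(1) l(1) l'(1)] l l' by simp
  ultimately show ?thesis
    unfolding comparison_def using add_hom[OF hh] add_hom[OF l(1) l'(1)] by blast
qed

end

section \<open>Left satellites of additive functors\<close>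

lemma additive_functorD:
  assumes "additive_functor C D F"
  shows "a \<in> Ob C \<Longrightarrow> fob F a \<in> Ob D"
    and "a \<in> Ob C \<Longrightarrow> far F (Id C a) = Id D (fob F a)"
    and "f \<in> homset C a b \<Longrightarrow> far F f \<in> homset D (fob F a) (fob F b)"
    and "f \<in> homset C a b \<Longrightarrow> g \<in> homset C b c \<Longrightarrow>
      far F (g \<cdot>\<^bsub>C\<^esub> f) = far F g \<cdot>\<^bsub>D\<^esub> far F f"
    and "f \<in> homset C a b \<Longrightarrow> g \<in> homset C a b \<Longrightarrow>
      far F (Add C f g) = Add D (far F f) (far F g)"
  using assms unfolding additive_functor_def by blast+

lemma natural_transformationD:
  assumes "natural_transformation C D F G \<eta>"
  shows "a \<in> Ob C \<Longrightarrow> \<eta> a \<in> homset D (fob F a) (fob G a)"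
    and "f \<in> homset C a b \<Longrightarrow> \<eta> b \<cdot>\<^bsub>D\<^esub> far F f = far G f \<cdot>\<^bsub>D\<^esub> \<eta> a"
  using assms unfolding natural_transformation_def by blast+

lemma sat_Suc_inner: "sat C D R (Suc k) F = sat C D R k (sat1 C D R F)"
  by (induction k) simp_all

text \<open>The index has to be at least two on the left: for index one the map ends in
  \<open>F\<close> itself, which is not a satellite of \<open>sat1 C D R F\<close>.\<close>

lemma sat_conn_Suc_inner:
  "sat_conn C D R F (Suc (Suc k)) f g = sat_conn C D R (sat1 C D R F) (Suc k) f g"
  by (simp add: sat_conn_def sat_Suc_inner del: sat.simps(2))

locale satellite_setting = C: abelian_category C + D: abelian_category D
  for C :: "('o1, 'm1) ab_cat" and D :: "('o2, 'm2) ab_cat" +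
  fixes R :: "'o1 \<Rightarrow> 'm1 \<times> 'm1"
  assumes presentation: "M \<in> Ob C \<Longrightarrow> projective_presentation C M (R M)"
begin

abbreviation "syz M \<equiv> Dom C (fst (R M))"
abbreviation "cover M \<equiv> Cod C (fst (R M))"
abbreviation "incl F M \<equiv> sat_incl C D R F M"

lemma presentationD:
  assumes "M \<in> Ob C"
  shows "short_exact_pair C (R M)" "Cod C (snd (R M)) = M" "projective C (Dom C (snd (R M)))"
    "fst (R M) \<in> homset C (syz M) (cover M)" "snd (R M) \<in> homset C (cover M) M"
    "syz M \<in> Ob C"
  using presentation[OF assms] C.short_exact_hom(1,2)[of "fst (R M)" "snd (R M)"]
    C.hom_ob[of "fst (R M)"]
  unfolding projective_presentation_def by auto

section \<open>The satellite as a kernel, and its values on arrows\<close>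

lemma sat_incl_kernel:
  assumes "additive_functor C D F" "M \<in> Ob C"
  shows "is_kernel D (far F (fst (R M))) (incl F M)"
proof -
  have "far F (fst (R M)) \<in> Arr D"
    using additive_functorD(3)[OF assms(1) presentationD(4)[OF assms(2)]] by (simp add: homset_def)
  then show ?thesis
    unfolding sat_incl_def kern_def using D.kernels someI_ex by metis
qed

lemma sat_incl_hom:
  assumes "additive_functor C D F" "M \<in> Ob C"
  shows "incl F M \<in> homset D (fob (sat1 C D R F) M) (fob F (syz M))"
    and "far F (fst (R M)) \<cdot>\<^bsub>D\<^esub> incl F M = Zer D (fob (sat1 C D R F) M) (fob F (cover M))"
  using D.is_kernel_hom[OF sat_incl_kernel[OF assms]]
    additive_functorD(3)[OF assms(1) presentationD(4)[OF assms(2)], THEN homsetD(2)]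
    additive_functorD(3)[OF assms(1) presentationD(4)[OF assms(2)], THEN homsetD(3)]
  by (simp_all add: sat1_def)

lemma sat_incl_mono:
  assumes "additive_functor C D F" "M \<in> Ob C"
    and "u \<in> homset D a (fob (sat1 C D R F) M)" "v \<in> homset D a (fob (sat1 C D R F) M)"
    and "incl F M \<cdot>\<^bsub>D\<^esub> u = incl F M \<cdot>\<^bsub>D\<^esub> v"
  shows "u = v"
  using D.is_kernel_mono[OF sat_incl_kernel[OF assms(1,2)]] assms(3-5) by (simp add: sat1_def)

lemma factor_sat_incl:
  assumes "additive_functor C D F" "M \<in> Ob C" "h \<in> homset D a (fob F (syz M))"
    and "far F (fst (R M)) \<cdot>\<^bsub>D\<^esub> h = Zer D a (fob F (cover M))"
  shows "factor D (incl F M) h \<in> homset D a (fob (sat1 C D R F) M)"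
    and "incl F M \<cdot>\<^bsub>D\<^esub> factor D (incl F M) h = h"
  using D.factor_kernel[OF sat_incl_kernel[OF assms(1,2)], of h a] assms(3,4)
    additive_functorD(3)[OF assms(1) presentationD(4)[OF assms(2)], THEN homsetD(2)]
    additive_functorD(3)[OF assms(1) presentationD(4)[OF assms(2)], THEN homsetD(3)]
  by (simp_all add: sat1_def)

lemma comparison_presentation_exists:
  assumes M: "M \<in> Ob C" and r: "short_exact_pair C r" and a: "a \<in> homset C M (Cod C (snd r))"
  shows "comparison C (R M) a r
    (factor C (fst r) (lift_arr C (a \<cdot>\<^bsub>C\<^esub> snd (R M)) (snd r) \<cdot>\<^bsub>C\<^esub> fst (R M)))"
  using C.comparison_exists[OF presentationD(1)[OF M] presentationD(3)[OF M] r]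
    a presentationD(2)[OF M] by simp

lemma syz_map_comparison:
  assumes "a \<in> homset C M N"
  shows "comparison C (R M) a (R N) (syz_map C R a)"
  using comparison_presentation_exists[of M "R N" a] presentationD(1,2)[of N]
    C.hom_ob[OF assms] assms homsetD[OF assms]
  by (simp add: syz_map_def Let_def)

text \<open>
  Two comparison maps differ by a map through the projective cover, which the functor kills on the
  kernel. This makes satellites independent of the chosen lifts.
\<close>

lemma far_comparison_unique:
  assumes F: "additive_functor C D F" and M: "M \<in> Ob C" and r: "short_exact_pair C r"
    and h: "comparison C (R M) a r h" and h': "comparison C (R M) a r h'"
  shows "far F h' \<cdot>\<^bsub>D\<^esub> incl F M = far F h \<cdot>\<^bsub>D\<^esub> incl F M"
proof -
  note e = presentationD[OF M] and i = sat_incl_hom[OF F M]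
  obtain s where s: "s \<in> homset C (cover M) (Dom C (fst r))"
    and eq: "h' = Add C h (s \<cdot>\<^bsub>C\<^esub> fst (R M))"
    using C.comparison_homotopic[OF e(1) r h h'] .
  have hh: "h \<in> homset C (syz M) (Dom C (fst r))" using h by (simp add: comparison_def)
  have sf: "s \<cdot>\<^bsub>C\<^esub> fst (R M) \<in> homset C (syz M) (Dom C (fst r))" using C.comp_hom[OF e(4) s] .
  note Fh = additive_functorD(3)[OF F hh] and Fsf = additive_functorD(3)[OF F sf]
    and Fs = additive_functorD(3)[OF F s] and Ff = additive_functorD(3)[OF F e(4)]
  have hi: "far F h \<cdot>\<^bsub>D\<^esub> incl F M \<in> homset D (fob (sat1 C D R F) M) (fob F (Dom C (fst r)))"
    using D.comp_hom[OF i(1) Fh] .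
  have "far F h' \<cdot>\<^bsub>D\<^esub> incl F M =
      Add D (far F h \<cdot>\<^bsub>D\<^esub> incl F M) (far F (s \<cdot>\<^bsub>C\<^esub> fst (R M)) \<cdot>\<^bsub>D\<^esub> incl F M)"
    using eq additive_functorD(5)[OF F hh sf] D.comp_add_left[OF i(1) Fh Fsf] by simp
  also have "far F (s \<cdot>\<^bsub>C\<^esub> fst (R M)) \<cdot>\<^bsub>D\<^esub> incl F M = far F s \<cdot>\<^bsub>D\<^esub> (far F (fst (R M)) \<cdot>\<^bsub>D\<^esub> incl F M)"
    using additive_functorD(4)[OF F e(4) s] D.comp_assoc[OF i(1) Ff Fs] by simp
  also have "\<dots> = Zer D (fob (sat1 C D R F) M) (fob F (Dom C (fst r)))"
    using i(2) D.comp_zero_right[OF Fs] D.hom_ob(1)[OF i(1)] by simp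
  finally show ?thesis using D.add_zero_right[OF hi] by simp
qed

text \<open>Any comparison map may stand for the chosen \<open>syz_map\<close>. Together with
  \<open>sat_incl_mono\<close> this replaces the definition of the satellite of an arrow from here
  on.\<close>

lemma sat1_far:
  assumes F: "additive_functor C D F" and a: "a \<in> homset C M N"
    and h: "comparison C (R M) a (R N) h"
  shows "far (sat1 C D R F) a \<in> homset D (fob (sat1 C D R F) M) (fob (sat1 C D R F) N)"
    and "incl F N \<cdot>\<^bsub>D\<^esub> far (sat1 C D R F) a = far F h \<cdot>\<^bsub>D\<^esub> incl F M"
proof -
  note M = C.hom_ob(1)[OF a] and N = C.hom_ob(2)[OF a]
  note e = presentationD[OF M] and e' = presentationD[OF N] and i = sat_incl_hom[OF F M]
  let ?h = "syz_map C R a"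
  note sh = syz_map_comparison[OF a]
  obtain l where l: "l \<in> homset C (cover M) (cover N)" "fst (R N) \<cdot>\<^bsub>C\<^esub> ?h = l \<cdot>\<^bsub>C\<^esub> fst (R M)"
    using sh unfolding comparison_def by blast
  have hh: "?h \<in> homset C (syz M) (syz N)" using sh by (simp add: comparison_def)
  note Fh = additive_functorD(3)[OF F hh] and Fl = additive_functorD(3)[OF F l(1)]
    and Ff = additive_functorD(3)[OF F e(4)] and Ff' = additive_functorD(3)[OF F e'(4)]
  have hom: "far F ?h \<cdot>\<^bsub>D\<^esub> incl F M \<in> homset D (fob (sat1 C D R F) M) (fob F (syz N))"
    using D.comp_hom[OF i(1) Fh] .
  \<comment> \<open>The map of covers \<open>l\<close> carries the composite back to the
    presentation of \<open>M\<close>, where the kernel inclusion is killed.\<close>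
  have "far F (fst (R N)) \<cdot>\<^bsub>D\<^esub> (far F ?h \<cdot>\<^bsub>D\<^esub> incl F M) = far F l \<cdot>\<^bsub>D\<^esub> (far F (fst (R M)) \<cdot>\<^bsub>D\<^esub> incl F M)"
    using D.comp_square[OF Fh Ff' Ff Fl _ i(1)]
      additive_functorD(4)[OF F hh e'(4)] additive_functorD(4)[OF F e(4) l(1)] l(2) by simp
  also have "\<dots> = Zer D (fob (sat1 C D R F) M) (fob F (cover N))"
    using i(2) D.comp_zero_right[OF Fl] D.hom_ob(1)[OF i(1)] by simp
  finally have z: "far F (fst (R N)) \<cdot>\<^bsub>D\<^esub> (far F ?h \<cdot>\<^bsub>D\<^esub> incl F M) =
    Zer D (fob (sat1 C D R F) M) (fob F (cover N))" .
  have eq: "far (sat1 C D R F) a = factor D (incl F N) (far F ?h \<cdot>\<^bsub>D\<^esub> incl F M)"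
    using homsetD[OF a] by (simp add: sat1_def)
  show "far (sat1 C D R F) a \<in> homset D (fob (sat1 C D R F) M) (fob (sat1 C D R F) N)"
    using factor_sat_incl(1)[OF F N hom z] eq by simp
  show "incl F N \<cdot>\<^bsub>D\<^esub> far (sat1 C D R F) a = far F h \<cdot>\<^bsub>D\<^esub> incl F M"
    using factor_sat_incl(2)[OF F N hom z] eq far_comparison_unique[OF F M e'(1) h sh] by simp
qed

lemma sat1_ob:
  assumes "additive_functor C D F" "M \<in> Ob C"
  shows "fob (sat1 C D R F) M \<in> Ob D"
  using D.hom_ob(1)[OF sat_incl_hom(1)[OF assms]] .

text \<open>Every equation is checked after composing with the kernel inclusion, a monomorphism,
  where the satellite of an arrow becomes \<open>F\<close> of a comparison map.\<close>

lemma sat1_additive: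
  assumes F: "additive_functor C D F"
  shows "additive_functor C D (sat1 C D R F)"
  unfolding additive_functor_def
proof (intro conjI allI ballI)
  let ?S = "sat1 C D R F"
  fix M assume M: "M \<in> Ob C"
  note e = presentationD[OF M] and i = sat_incl_hom[OF F M]
  show ob: "fob ?S M \<in> Ob D" by (rule sat1_ob[OF F M])
  have h: "comparison C (R M) (Id C M) (R M) (Id C (syz M))"
    using C.comparison_id[OF e(1)] e(2) by simp
  note s = sat1_far[OF F C.id_hom[OF M] h]
  have "incl F M \<cdot>\<^bsub>D\<^esub> far ?S (Id C M) = incl F M \<cdot>\<^bsub>D\<^esub> Id D (fob ?S M)"
    using s(2) additive_functorD(2)[OF F e(6)] D.comp_id_left[OF i(1)] D.comp_id_right[OF i(1)]
    by simp
  then show "far ?S (Id C M) = Id D (fob ?S M)"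
    using sat_incl_mono[OF F M s(1) D.id_hom[OF ob]] by simp
next
  fix M N a assume "a \<in> homset C M N"
  then show "far (sat1 C D R F) a \<in> homset D (fob (sat1 C D R F) M) (fob (sat1 C D R F) N)"
    using sat1_far(1)[OF F _ syz_map_comparison] by simp
next
  let ?S = "sat1 C D R F"
  fix M N L a b assume a: "a \<in> homset C M N" and b: "b \<in> homset C N L"
  note M = C.hom_ob(1)[OF a] and N = C.hom_ob(2)[OF a] and L = C.hom_ob(2)[OF b]
  note eM = presentationD[OF M] and eN = presentationD[OF N] and eL = presentationD[OF L]
  note ha = syz_map_comparison[OF a] and hb = syz_map_comparison[OF b]
  \<comment> \<open>The composite of the two syzygy maps serves in place of the one chosen for the
    composite arrow.\<close>
  have hab: "comparison C (R M) (b \<cdot>\<^bsub>C\<^esub> a) (R L) (syz_map C R b \<cdot>\<^bsub>C\<^esub> syz_map C R a)"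
    using C.comparison_comp[OF eM(1) eN(1) eL(1) _ _ ha hb] a b eM(2) eN(2) eL(2) by simp
  have h: "syz_map C R a \<in> homset C (syz M) (syz N)" "syz_map C R b \<in> homset C (syz N) (syz L)"
    using ha hb by (simp_all add: comparison_def)
  note sa = sat1_far[OF F a ha] and sb = sat1_far[OF F b hb]
    and sab = sat1_far[OF F C.comp_hom[OF a b] hab]
  note Fa = additive_functorD(3)[OF F h(1)] and Fb = additive_functorD(3)[OF F h(2)]
  note iM = sat_incl_hom(1)[OF F M] and iN = sat_incl_hom(1)[OF F N] and iL = sat_incl_hom(1)[OF F L]
  have "incl F L \<cdot>\<^bsub>D\<^esub> far ?S (b \<cdot>\<^bsub>C\<^esub> a) =
      far F (syz_map C R b) \<cdot>\<^bsub>D\<^esub> (far F (syz_map C R a) \<cdot>\<^bsub>D\<^esub> incl F M)"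
    using sab(2) additive_functorD(4)[OF F h] D.comp_assoc[OF iM Fa Fb] by simp
  also have "\<dots> = (far F (syz_map C R b) \<cdot>\<^bsub>D\<^esub> incl F N) \<cdot>\<^bsub>D\<^esub> far ?S a"
    using sa(2) D.comp_assoc[OF sa(1) iN Fb] by simp
  also have "\<dots> = incl F L \<cdot>\<^bsub>D\<^esub> (far ?S b \<cdot>\<^bsub>D\<^esub> far ?S a)"
    using sb(2) D.comp_assoc[OF sa(1) sb(1) iL] by simp
  finally show "far ?S (b \<cdot>\<^bsub>C\<^esub> a) = far ?S b \<cdot>\<^bsub>D\<^esub> far ?S a"
    using sat_incl_mono[OF F L sab(1) D.comp_hom[OF sa(1) sb(1)]] by simp
next
  let ?S = "sat1 C D R F"
  fix M N a b assume a: "a \<in> homset C M N" and b: "b \<in> homset C M N"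
  note M = C.hom_ob(1)[OF a] and N = C.hom_ob(2)[OF a]
  note eM = presentationD[OF M] and eN = presentationD[OF N]
  note ha = syz_map_comparison[OF a] and hb = syz_map_comparison[OF b]
  have hab: "comparison C (R M) (Add C a b) (R N) (Add C (syz_map C R a) (syz_map C R b))"
    using C.comparison_add[OF eM(1) eN(1) _ _ ha hb] a b eM(2) eN(2) by simp
  have h: "syz_map C R a \<in> homset C (syz M) (syz N)" "syz_map C R b \<in> homset C (syz M) (syz N)"
    using ha hb by (simp_all add: comparison_def)
  note sa = sat1_far[OF F a ha] and sb = sat1_far[OF F b hb]
    and sab = sat1_far[OF F C.add_hom[OF a b] hab]
  note Fa = additive_functorD(3)[OF F h(1)] and Fb = additive_functorD(3)[OF F h(2)]
  note iM = sat_incl_hom(1)[OF F M] and iN = sat_incl_hom(1)[OF F N]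
  have "incl F N \<cdot>\<^bsub>D\<^esub> far ?S (Add C a b) = incl F N \<cdot>\<^bsub>D\<^esub> Add D (far ?S a) (far ?S b)"
    using sab(2) sa(2) sb(2) additive_functorD(5)[OF F h] D.comp_add_left[OF iM Fa Fb]
      D.comp_add_right[OF sa(1) sb(1) iN] by simp
  then show "far ?S (Add C a b) = Add D (far ?S a) (far ?S b)"
    using sat_incl_mono[OF F N sab(1) D.add_hom[OF sa(1) sb(1)]] by simp
qed

lemma sat_additive: "additive_functor C D F \<Longrightarrow> additive_functor C D (sat C D R k F)"
  by (induction k) (simp_all add: sat1_additive)

section \<open>Satellites of natural transformations\<close>

lemma sat1_nat_at:
  assumes F: "additive_functor C D F" and G: "additive_functor C D G"
    and n: "natural_transformation C D F G \<phi>" and M: "M \<in> Ob C"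
  shows "sat1_nat C D R F G \<phi> M \<in> homset D (fob (sat1 C D R F) M) (fob (sat1 C D R G) M)"
    and "incl G M \<cdot>\<^bsub>D\<^esub> sat1_nat C D R F G \<phi> M = \<phi> (syz M) \<cdot>\<^bsub>D\<^esub> incl F M"
proof -
  note e = presentationD[OF M] and i = sat_incl_hom[OF F M]
  note p = natural_transformationD(1)[OF n e(6)]
    and p' = natural_transformationD(1)[OF n C.hom_ob(2)[OF e(4)]]
  note hom = D.comp_hom[OF i(1) p]
  \<comment> \<open>Naturality at the arrow from the syzygy to the cover shows that
    \<open>\<phi>\<close> at the syzygy maps one kernel into the other.\<close>
  have "far G (fst (R M)) \<cdot>\<^bsub>D\<^esub> (\<phi> (syz M) \<cdot>\<^bsub>D\<^esub> incl F M) =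
      \<phi> (cover M) \<cdot>\<^bsub>D\<^esub> (far F (fst (R M)) \<cdot>\<^bsub>D\<^esub> incl F M)"
    by (rule D.comp_square[OF p additive_functorD(3)[OF G e(4)] additive_functorD(3)[OF F e(4)] p'
          natural_transformationD(2)[OF n e(4), symmetric] i(1)])
  also have "\<dots> = Zer D (fob (sat1 C D R F) M) (fob G (cover M))"
    using i(2) D.comp_zero_right[OF p'] D.hom_ob(1)[OF i(1)] by simp
  finally have z: "far G (fst (R M)) \<cdot>\<^bsub>D\<^esub> (\<phi> (syz M) \<cdot>\<^bsub>D\<^esub> incl F M) =
    Zer D (fob (sat1 C D R F) M) (fob G (cover M))" .
  show "sat1_nat C D R F G \<phi> M \<in> homset D (fob (sat1 C D R F) M) (fob (sat1 C D R G) M)"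
    "incl G M \<cdot>\<^bsub>D\<^esub> sat1_nat C D R F G \<phi> M = \<phi> (syz M) \<cdot>\<^bsub>D\<^esub> incl F M"
    using factor_sat_incl[OF G M hom z] by (simp_all add: sat1_nat_def)
qed

lemma sat1_nat_natural:
  assumes F: "additive_functor C D F" and G: "additive_functor C D G"
    and n: "natural_transformation C D F G \<phi>"
  shows "natural_transformation C D (sat1 C D R F) (sat1 C D R G) (sat1_nat C D R F G \<phi>)"
  unfolding natural_transformation_def
proof (intro conjI allI ballI)
  let ?S = "sat1_nat C D R F G \<phi>"
  show "?S M \<in> homset D (fob (sat1 C D R F) M) (fob (sat1 C D R G) M)" if "M \<in> Ob C" for M
    using sat1_nat_at(1)[OF F G n that] .
  fix M N a assume a: "a \<in> homset C M N"
  note M = C.hom_ob(1)[OF a] and N = C.hom_ob(2)[OF a]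
  note ha = syz_map_comparison[OF a]
  have h: "syz_map C R a \<in> homset C (syz M) (syz N)" using ha by (simp add: comparison_def)
  note f = sat1_far[OF F a ha] and g = sat1_far[OF G a ha]
  note m = sat1_nat_at[OF F G n M] and n' = sat1_nat_at[OF F G n N]
  note iF = sat_incl_hom(1)[OF F M] and iG = sat_incl_hom(1)[OF G M]
  note iF' = sat_incl_hom(1)[OF F N] and iG' = sat_incl_hom(1)[OF G N]
  note Fh = additive_functorD(3)[OF F h] and Gh = additive_functorD(3)[OF G h]
  note pM = natural_transformationD(1)[OF n presentationD(6)[OF M]]
    and pN = natural_transformationD(1)[OF n presentationD(6)[OF N]]
  \<comment> \<open>The wanted square is one face of a cube whose other faces commute; it is
    recovered by cancelling the kernel inclusion at \<open>N\<close>.\<close>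
  have "incl G N \<cdot>\<^bsub>D\<^esub> (?S N \<cdot>\<^bsub>D\<^esub> far (sat1 C D R F) a) = \<phi> (syz N) \<cdot>\<^bsub>D\<^esub> (incl F N \<cdot>\<^bsub>D\<^esub> far (sat1 C D R F) a)"
    by (rule D.comp_square[OF n'(1) iG' iF' pN n'(2) f(1)])
  also have "\<dots> = \<phi> (syz N) \<cdot>\<^bsub>D\<^esub> (far F (syz_map C R a) \<cdot>\<^bsub>D\<^esub> incl F M)" using f(2) by simp
  also have "\<dots> = far G (syz_map C R a) \<cdot>\<^bsub>D\<^esub> (\<phi> (syz M) \<cdot>\<^bsub>D\<^esub> incl F M)"
    by (rule D.comp_square[OF Fh pN pM Gh natural_transformationD(2)[OF n h] iF])
  also have "\<dots> = far G (syz_map C R a) \<cdot>\<^bsub>D\<^esub> (incl G M \<cdot>\<^bsub>D\<^esub> ?S M)" using m(2) by simp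
  also have "\<dots> = incl G N \<cdot>\<^bsub>D\<^esub> (far (sat1 C D R G) a \<cdot>\<^bsub>D\<^esub> ?S M)"
    by (rule D.comp_square[OF iG Gh g(1) iG' g(2)[symmetric] m(1)])
  finally show "?S N \<cdot>\<^bsub>D\<^esub> far (sat1 C D R F) a = far (sat1 C D R G) a \<cdot>\<^bsub>D\<^esub> ?S M"
    using sat_incl_mono[OF G N D.comp_hom[OF f(1) n'(1)] D.comp_hom[OF m(1) g(1)]] by simp
qed

lemma sat_nat_natural:
  assumes "additive_functor C D F" "additive_functor C D G" "natural_transformation C D F G \<phi>"
  shows "natural_transformation C D (sat C D R k F) (sat C D R k G) (sat_nat C D R k F G \<phi>)"
  by (induction k) (simp_all add: assms sat1_nat_natural sat_additive)

section \<open>Connecting homomorphisms of satellites\<close>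

lemma sat_conn_eq:
  assumes F: "additive_functor C D F" and e: "short_exact C f g"
    and h: "comparison C (R (Cod C g)) (Id C (Cod C g)) (f, g) h"
  shows "sat_conn C D R F (Suc k) f g =
    far (sat C D R k F) h \<cdot>\<^bsub>D\<^esub> incl (sat C D R k F) (Cod C g)"
proof -
  let ?M = "Cod C g"
  have M: "?M \<in> Ob C" using C.hom_ob C.short_exact_hom(2)[OF e] by blast
  \<comment> \<open>\<open>sat_conn\<close> lifts the map from the cover itself, a comparison lifts
    its composite with the identity; the two prescriptions agree.\<close>
  have "Id C ?M \<cdot>\<^bsub>C\<^esub> snd (R ?M) = snd (R ?M)" using C.comp_id_left presentationD(5)[OF M] by blast
  then have "comparison C (R ?M) (Id C ?M) (f, g)
      (factor C f (lift_arr C (snd (R ?M)) g \<cdot>\<^bsub>C\<^esub> fst (R ?M)))"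
    using comparison_presentation_exists[OF M, of "(f, g)" "Id C ?M"] C.id_hom[OF M] e by simp
  from far_comparison_unique[OF sat_additive[OF F] M _ h this] show ?thesis
    using e by (simp add: sat_conn_def Let_def)
qed

lemma connecting_comparison:
  assumes "short_exact C f g"
  obtains h where "comparison C (R (Cod C g)) (Id C (Cod C g)) (f, g) h"
    "h \<in> homset C (syz (Cod C g)) (Dom C f)"
proof -
  have M: "Cod C g \<in> Ob C" using C.hom_ob C.short_exact_hom(2)[OF assms] by blast
  from comparison_presentation_exists[OF M, of "(f, g)" "Id C (Cod C g)"] assms C.id_hom[OF M] that
  show thesis by (auto simp: comparison_def)
qed

lemma sat_conn_hom:
  assumes F: "additive_functor C D F" and e: "short_exact C f g"
  shows "sat_conn C D R F (Suc k) f g \<in>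
    homset D (fob (sat C D R (Suc k) F) (Cod C g)) (fob (sat C D R k F) (Dom C f))"
proof -
  obtain h where h: "comparison C (R (Cod C g)) (Id C (Cod C g)) (f, g) h"
    "h \<in> homset C (syz (Cod C g)) (Dom C f)" using connecting_comparison[OF e] .
  have M: "Cod C g \<in> Ob C" using C.hom_ob C.short_exact_hom(2)[OF e] by blast
  note S = sat_additive[OF F, of k]
  show ?thesis
    using sat_conn_eq[OF F e h(1)] D.comp_hom[OF sat_incl_hom(1)[OF S M] additive_functorD(3)[OF S h(2)]]
    by simp
qed

text \<open>For the chosen presentation the identity of the syzygy is a comparison map, so only the
  inclusion is left.\<close>

lemma sat_conn_presentation:
  assumes F: "additive_functor C D F" and M: "M \<in> Ob C"
  shows "sat_conn C D R F (Suc k) (fst (R M)) (snd (R M)) = incl (sat C D R k F) M"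
proof -
  note e = presentationD[OF M] and S = sat_additive[OF F, of k]
  have "comparison C (R M) (Id C M) (R M) (Id C (syz M))"
    using C.comparison_id[OF e(1)] e(2) by simp
  then show ?thesis
    using sat_conn_eq[OF F e(1), of "Id C (syz M)"] e(2) additive_functorD(2)[OF S e(6)]
      D.comp_id_left[OF sat_incl_hom(1)[OF S M]] by simp
qed

text \<open>The comparison map \<open>h\<close> lives in \<open>C\<close> and is the same for both
  functors. Naturality at \<open>h\<close> and compatibility with the kernel inclusions give the two
  halves of the square.\<close>

lemma sat_conn_natural:
  assumes F: "additive_functor C D F" and G: "additive_functor C D G"
    and n: "natural_transformation C D F G \<phi>" and e: "short_exact C f g"
  shows "sat_nat C D R k F G \<phi> (Dom C f) \<cdot>\<^bsub>D\<^esub> sat_conn C D R F (Suc k) f g =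
    sat_conn C D R G (Suc k) f g \<cdot>\<^bsub>D\<^esub> sat_nat C D R (Suc k) F G \<phi> (Cod C g)"
proof -
  obtain h where h: "comparison C (R (Cod C g)) (Id C (Cod C g)) (f, g) h"
    "h \<in> homset C (syz (Cod C g)) (Dom C f)" using connecting_comparison[OF e] .
  let ?M = "Cod C g" and ?F = "sat C D R k F" and ?G = "sat C D R k G"
    and ?p = "sat_nat C D R k F G \<phi>"
  have M: "?M \<in> Ob C" using C.hom_ob C.short_exact_hom(2)[OF e] by blast
  note SF = sat_additive[OF F, of k] and SG = sat_additive[OF G, of k]
  note p = sat_nat_natural[OF F G n, of k]
  note pA = natural_transformationD(1)[OF p C.hom_ob(2)[OF h(2)]]
    and pK = natural_transformationD(1)[OF p C.hom_ob(1)[OF h(2)]]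
  note Fh = additive_functorD(3)[OF SF h(2)] and Gh = additive_functorD(3)[OF SG h(2)]
  note iF = sat_incl_hom(1)[OF SF M] and iG = sat_incl_hom(1)[OF SG M]
  note m = sat1_nat_at[OF SF SG p M]
  have "?p (Dom C f) \<cdot>\<^bsub>D\<^esub> sat_conn C D R F (Suc k) f g =
      ?p (Dom C f) \<cdot>\<^bsub>D\<^esub> (far ?F h \<cdot>\<^bsub>D\<^esub> incl ?F ?M)"
    using sat_conn_eq[OF F e h(1)] by simp
  also have "\<dots> = far ?G h \<cdot>\<^bsub>D\<^esub> (?p (syz ?M) \<cdot>\<^bsub>D\<^esub> incl ?F ?M)"
    by (rule D.comp_square[OF Fh pA pK Gh natural_transformationD(2)[OF p h(2)] iF])
  also have "\<dots> = (far ?G h \<cdot>\<^bsub>D\<^esub> incl ?G ?M) \<cdot>\<^bsub>D\<^esub> sat_nat C D R (Suc k) F G \<phi> ?M"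
    using m(2) D.comp_assoc[OF m(1) iG Gh] by simp
  also have "\<dots> = sat_conn C D R G (Suc k) f g \<cdot>\<^bsub>D\<^esub> sat_nat C D R (Suc k) F G \<phi> ?M"
    using sat_conn_eq[OF G e h(1)] by simp
  finally show ?thesis .
qed

end

section \<open>Sequential direct limits\<close>

lemma direct_systemD:
  assumes "direct_system D X"
  shows "i \<in> idx X \<Longrightarrow> obj X i \<in> Ob D" "i \<in> idx X \<Longrightarrow> trn X i i = Id D (obj X i)"
    and "i \<in> idx X \<Longrightarrow> j \<in> idx X \<Longrightarrow> leq X i j \<Longrightarrow> trn X i j \<in> homset D (obj X i) (obj X j)"
    and "i \<in> idx X \<Longrightarrow> j \<in> idx X \<Longrightarrow> k \<in> idx X \<Longrightarrow> leq X i j \<Longrightarrow> leq X j k \<Longrightarrow>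
      trn X j k \<cdot>\<^bsub>D\<^esub> trn X i j = trn X i k"
  using assms unfolding direct_system_def by blast+

lemma is_coconeD:
  assumes "is_cocone D X L c"
  shows "L \<in> Ob D" "i \<in> idx X \<Longrightarrow> c i \<in> homset D (obj X i) L"
    and "i \<in> idx X \<Longrightarrow> j \<in> idx X \<Longrightarrow> leq X i j \<Longrightarrow> c j \<cdot>\<^bsub>D\<^esub> trn X i j = c i"
  using assms unfolding is_cocone_def by blast+

text \<open>Limits are assumed for index sets inside \<open>'i\<close>, while the systems here are
  indexed by numbers; an infinite type contains a copy of the numbers, along which the system is
  transported.\<close>

lemma nat_direct_limit_exists:
  fixes X :: "(nat, 'o, 'm) dsys"
  assumes D: "has_exact_direct_limits TYPE('i::infinite) D" and X: "direct_system D X"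
  shows "\<exists>L c. is_direct_limit D X L c"
proof -
  obtain \<iota> :: "nat \<Rightarrow> 'i" where \<iota>: "inj \<iota>"
    using infinite_countable_subset[OF infinite_UNIV] by blast
  define \<kappa> where "\<kappa> = inv_into UNIV \<iota>"
  have inv: "\<kappa> (\<iota> i) = i" for i using inv_into_f_f[OF \<iota>] by (simp add: \<kappa>_def)
  \<comment> \<open>Cocones on \<open>X\<close> and on this copy correspond by reindexing, so a
    limit of the copy is one of \<open>X\<close>.\<close>
  define Y where "Y = \<lparr>idx = \<iota> ` idx X, leq = (\<lambda>a b. leq X (\<kappa> a) (\<kappa> b)),
    obj = (\<lambda>a. obj X (\<kappa> a)), trn = (\<lambda>a b. trn X (\<kappa> a) (\<kappa> b))\<rparr>"
  have "directed_set (idx Y) (leq Y) \<longleftrightarrow> directed_set (idx X) (leq X)"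
    unfolding directed_set_def by (simp add: Y_def inv)
  then have "direct_system D Y \<longleftrightarrow> direct_system D X"
    unfolding direct_system_def by (simp add: Y_def inv)
  with X have "direct_system D Y" by simp
  then obtain L c where lim: "is_direct_limit D Y L c"
    using D unfolding has_exact_direct_limits_def by blast
  have YX: "is_cocone D X Z (\<lambda>i. d (\<iota> i))" if "is_cocone D Y Z d" for Z d
    using that unfolding is_cocone_def by (simp add: Y_def inv)
  have XY: "is_cocone D Y Z (\<lambda>a. d (\<kappa> a))" if "is_cocone D X Z d" for Z d
    using that unfolding is_cocone_def by (simp add: Y_def inv)
  have "is_direct_limit D X L (\<lambda>i. c (\<iota> i))"
    unfolding is_direct_limit_def
  proof (intro conjI allI impI)
    show "direct_system D X" by (rule X)
    show "is_cocone D X L (\<lambda>i. c (\<iota> i))" using YX lim by (simp add: is_direct_limit_def)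
    fix Z d assume "is_cocone D X Z d"
    from XY[OF this] lim have
      "\<exists>!u. u \<in> homset D L Z \<and> (\<forall>a\<in>idx Y. u \<cdot>\<^bsub>D\<^esub> c a = d (\<kappa> a))"
      unfolding is_direct_limit_def by blast
    then show "\<exists>!u. u \<in> homset D L Z \<and> (\<forall>i\<in>idx X. u \<cdot>\<^bsub>D\<^esub> c (\<iota> i) = d i)"
      by (simp add: Y_def inv)
  qed
  then show ?thesis by blast
qed

lemma dlim_is_direct_limit:
  assumes "\<exists>L c. is_direct_limit D X L c"
  shows "is_direct_limit D X (fst (dlim D X)) (snd (dlim D X))"
  unfolding dlim_def by (rule someI_ex) (use assms in auto)

context category
begin

text \<open>The legs into the limit of \<open>Y\<close>, composed with \<open>\<phi>\<close>, form a
  cocone on \<open>X\<close>; its unique mediating arrow is what the definite description in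
  \<open>dlim_map\<close> denotes.\<close>

lemma dlim_map_is_direct_limit_map:
  assumes X: "\<exists>L c. is_direct_limit C X L c" and Y: "\<exists>L c. is_direct_limit C Y L c"
    and \<phi>: "dsys_morphism C X Y \<phi>"
  shows "is_direct_limit_map C X (fst (dlim C X)) (snd (dlim C X))
    Y (fst (dlim C Y)) (snd (dlim C Y)) \<phi> (dlim_map C X Y \<phi>)"
proof -
  let ?L = "fst (dlim C X)" and ?c = "snd (dlim C X)" and ?L' = "fst (dlim C Y)"
    and ?c' = "snd (dlim C Y)"
  note lX = dlim_is_direct_limit[OF X] and lY = dlim_is_direct_limit[OF Y]
  have cY: "is_cocone C Y ?L' ?c'" and dX: "direct_system C X"
    using lX lY by (simp_all add: is_direct_limit_def)
  have ix: "idx X = idx Y" "leq X = leq Y"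
    and ph: "\<And>i. i \<in> idx X \<Longrightarrow> \<phi> i \<in> homset C (obj X i) (obj Y i)"
    and pc: "\<And>i j. i \<in> idx X \<Longrightarrow> j \<in> idx X \<Longrightarrow> leq X i j \<Longrightarrow>
        trn Y i j \<cdot> \<phi> i = \<phi> j \<cdot> trn X i j"
    and dY: "direct_system C Y"
    using \<phi> unfolding dsys_morphism_def by blast+
  have "is_cocone C X ?L' (\<lambda>i. ?c' i \<cdot> \<phi> i)"
    unfolding is_cocone_def
  proof (intro conjI ballI impI)
    show "?L' \<in> Ob C" using is_coconeD(1)[OF cY] .
    show "?c' i \<cdot> \<phi> i \<in> homset C (obj X i) ?L'" if "i \<in> idx X" for i
      using comp_hom[OF ph[OF that] is_coconeD(2)[OF cY]] that ix by simp
    fix i j assume i: "i \<in> idx X" and j: "j \<in> idx X" and l: "leq X i j"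
    have cj: "?c' j \<in> homset C (obj Y j) ?L'" and tY: "trn Y i j \<in> homset C (obj Y i) (obj Y j)"
      and cji: "?c' j \<cdot> trn Y i j = ?c' i"
      using is_coconeD[OF cY] direct_systemD(3)[OF dY] i j l ix by simp_all
    have "(?c' j \<cdot> \<phi> j) \<cdot> trn X i j = ?c' j \<cdot> (\<phi> j \<cdot> trn X i j)"
      using comp_assoc[OF direct_systemD(3)[OF dX i j l] ph[OF j] cj] by simp
    also have "\<dots> = (?c' j \<cdot> trn Y i j) \<cdot> \<phi> i"
      using comp_assoc[OF ph[OF i] tY cj] pc[OF i j l] by simp
    finally show "(?c' j \<cdot> \<phi> j) \<cdot> trn X i j = ?c' i \<cdot> \<phi> i" using cji by simp
  qed
  with lX have "\<exists>!u. u \<in> homset C ?L ?L' \<and> (\<forall>i\<in>idx X. u \<cdot> ?c i = ?c' i \<cdot> \<phi> i)"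
    unfolding is_direct_limit_def by blast
  then have "\<exists>!u. is_direct_limit_map C X ?L ?c Y ?L' ?c' \<phi> u"
    using lX lY \<phi> by (simp add: is_direct_limit_map_def)
  from theI'[OF this] show ?thesis by (simp add: dlim_map_def)
qed

section \<open>Systems generated by one-step transitions\<close>

lemma seq_comp_hom:
  assumes t: "\<And>k. k \<ge> a \<Longrightarrow> t k \<in> homset C (x k) (x (Suc k))" and "k \<ge> a"
  shows "seq_comp C x t k d \<in> homset C (x k) (x (k + d))"
proof (induction d)
  case 0
  then show ?case using id_hom hom_ob(1)[OF t[OF assms(2)]] by simp
next
  case (Suc d)
  then show ?case using comp_hom[OF Suc t[of "k + d"]] assms(2) by simp
qed

lemma seq_comp_add:
  assumes t: "\<And>k. k \<ge> a \<Longrightarrow> t k \<in> homset C (x k) (x (Suc k))" and k: "k \<ge> a"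
  shows "seq_comp C x t (k + d) e \<cdot> seq_comp C x t k d = seq_comp C x t k (d + e)"
proof (induction e)
  case 0
  then show ?case using comp_id_left[OF seq_comp_hom[of a t x, OF t k]] by simp
next
  case (Suc e)
  have "seq_comp C x t (k + d) e \<in> homset C (x (k + d)) (x (k + d + e))"
    using seq_comp_hom[of a t x "k + d" e, OF t] k by simp
  then show ?case
    using comp_assoc[OF seq_comp_hom[of a t x k d, OF t k] _ t[of "k + d + e"],
        of "seq_comp C x t (k + d) e"] Suc k
    by (simp add: add.assoc)
qed

text \<open>\<open>seq_comp\<close> appends transitions at the late end. The first one has to be
  split off when the end is fixed and the start moves, as for legs that pass through a fixed later
  index.\<close>

lemma seq_comp_rec_left:
  assumes t: "\<And>k. k \<ge> a \<Longrightarrow> t k \<in> homset C (x k) (x (Suc k))" and k: "k \<ge> a"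
  shows "seq_comp C x t k (Suc d) = seq_comp C x t (Suc k) d \<cdot> t k"
  using seq_comp_add[of a t x k "Suc 0" d, OF t k] comp_id_right[OF t[OF k]] by simp

lemma seq_system_direct:
  assumes t: "\<And>k. k \<ge> a \<Longrightarrow> t k \<in> homset C (x k) (x (Suc k))"
  shows "direct_system C (seq_system C {a..} x t)"
  unfolding direct_system_def
proof (intro conjI ballI impI)
  show "directed_set (idx (seq_system C {a..} x t)) (leq (seq_system C {a..} x t))"
    unfolding directed_set_def seq_system_def by (auto intro: max.cobounded1 max.cobounded2)
  fix i assume i: "i \<in> idx (seq_system C {a..} x t)"
  then show "obj (seq_system C {a..} x t) i \<in> Ob C"
    using hom_ob(1)[OF t[of i]] by (simp add: seq_system_def)
  show "trn (seq_system C {a..} x t) i i = Id C (obj (seq_system C {a..} x t) i)"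
    by (simp add: seq_system_def)
  fix j assume j: "j \<in> idx (seq_system C {a..} x t)" and ij: "leq (seq_system C {a..} x t) i j"
  then show "trn (seq_system C {a..} x t) i j \<in>
      homset C (obj (seq_system C {a..} x t) i) (obj (seq_system C {a..} x t) j)"
    using i seq_comp_hom[of a t x i "j - i", OF t] by (simp add: seq_system_def)
  fix k assume k: "k \<in> idx (seq_system C {a..} x t)" and jk: "leq (seq_system C {a..} x t) j k"
  show "trn (seq_system C {a..} x t) j k \<cdot> trn (seq_system C {a..} x t) i j =
      trn (seq_system C {a..} x t) i k"
    using seq_comp_add[of a t x i "j - i" "k - j", OF t] i ij jk by (simp add: seq_system_def)
qed

lemma seq_system_cocone:
  assumes t: "\<And>k. k \<ge> a \<Longrightarrow> t k \<in> homset C (x k) (x (Suc k))" and L: "L \<in> Ob C"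
    and c: "\<And>k. k \<ge> a \<Longrightarrow> c k \<in> homset C (x k) L"
    and ct: "\<And>k. k \<ge> a \<Longrightarrow> c (Suc k) \<cdot> t k = c k"
  shows "is_cocone C (seq_system C {a..} x t) L c"
proof -
  have "c (k + d) \<cdot> seq_comp C x t k d = c k" if k: "k \<ge> a" for k d
  proof (induction d)
    case 0
    then show ?case using comp_id_right[OF c[OF k]] by simp
  next
    case (Suc d)
    then show ?case
      using comp_assoc[OF seq_comp_hom[of a t x, OF t k] t[of "k + d"] c[of "Suc (k + d)"]] ct[of "k + d"] k
      by simp
  qed
  then have "c j \<cdot> seq_comp C x t i (j - i) = c i" if "i \<ge> a" "i \<le> j" for i j
    using that le_add_diff_inverse by metis
  then show ?thesis
    using L c unfolding is_cocone_def by (auto simp: seq_system_def)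
qed

lemma seq_system_morphism:
  assumes t: "\<And>k. k \<ge> a \<Longrightarrow> t k \<in> homset C (x k) (x (Suc k))"
    and t': "\<And>k. k \<ge> a \<Longrightarrow> t' k \<in> homset C (x' k) (x' (Suc k))"
    and \<phi>: "\<And>k. k \<ge> a \<Longrightarrow> \<phi> k \<in> homset C (x k) (x' k)"
    and comm: "\<And>k. k \<ge> a \<Longrightarrow> t' k \<cdot> \<phi> k = \<phi> (Suc k) \<cdot> t k"
  shows "dsys_morphism C (seq_system C {a..} x t) (seq_system C {a..} x' t') \<phi>"
proof -
  have "seq_comp C x' t' k d \<cdot> \<phi> k = \<phi> (k + d) \<cdot> seq_comp C x t k d" if k: "k \<ge> a" for k d
  proof (induction d)
    case 0
    then show ?case using comp_id_left[OF \<phi>[OF k]] comp_id_right[OF \<phi>[OF k]] by simp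
  next
    case (Suc d)
    have kd: "k + d \<ge> a" using k by simp
    note s = seq_comp_hom[of a t x k d, OF t k] and s' = seq_comp_hom[of a t' x' k d, OF t' k]
    have "t' (k + d) \<cdot> (seq_comp C x' t' k d \<cdot> \<phi> k) = \<phi> (Suc (k + d)) \<cdot> (t (k + d) \<cdot> seq_comp C x t k d)"
      using comp_square[OF \<phi>[OF kd] t'[OF kd] t[OF kd] \<phi>[of "Suc (k + d)"] comm[OF kd] s] kd Suc by simp
    then show ?case using comp_assoc[OF \<phi>[OF k] s' t'[OF kd]] by simp
  qed
  then have "seq_comp C x' t' i (j - i) \<cdot> \<phi> i = \<phi> j \<cdot> seq_comp C x t i (j - i)"
    if "i \<ge> a" "i \<le> j" for i j
    using that le_add_diff_inverse by metis
  then show ?thesis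
    using seq_system_direct[of a t x, OF t] seq_system_direct[of a t' x', OF t'] \<phi>
    unfolding dsys_morphism_def by (auto simp: seq_system_def)
qed

text \<open>
  From \<open>k = p\<close> on, the second system is the tail of \<open>X\<close> starting at \<open>q\<close>; the truncated
  differences push the terms before \<open>p\<close> and \<open>q\<close> to these positions.
\<close>

lemma direct_limit_tail:
  assumes lim: "is_direct_limit C X L c" and idx: "idx X = UNIV" and leq: "leq X = (\<le>)"
    and t: "\<And>k. k \<ge> a \<Longrightarrow> t k \<in> homset C (x k) (x (Suc k))" and p: "p \<ge> a"
    and xX: "\<And>j. x (p + j) = obj X (q + j)"
    and tX: "\<And>j. t (p + j) = trn X (q + j) (Suc (q + j))"
  shows "is_direct_limit C (seq_system C {a..} x t) L
    (\<lambda>k. c (q + (k - p)) \<cdot> seq_comp C x t k (p - k))"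
proof -
  let ?S = "seq_system C {a..} x t"
  define c' where "c' k = c (q + (k - p)) \<cdot> seq_comp C x t k (p - k)" for k
  have X: "direct_system C X" and cc: "is_cocone C X L c" using lim by (simp_all add: is_direct_limit_def)
  have trn_hom: "trn X i j \<in> homset C (obj X i) (obj X j)" if "i \<le> j" for i j
    using direct_systemD(3)[OF X] that idx leq by simp
  have trn_comp: "trn X j k \<cdot> trn X i j = trn X i k" if "i \<le> j" "j \<le> k" for i j k
    using direct_systemD(4)[OF X] that idx leq by simp
  have trn_id: "trn X i i = Id C (obj X i)" for i using direct_systemD(2)[OF X] idx by simp
  have c: "c i \<in> homset C (obj X i) L" for i using is_coconeD(2)[OF cc] idx by simp
  have ct: "c j \<cdot> trn X i j = c i" if "i \<le> j" for i j
    using is_coconeD(3)[OF cc] that idx leq by simp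
  have s_hom: "seq_comp C x t k d \<in> homset C (x k) (x (k + d))" if "k \<ge> a" for k d
    using seq_comp_hom[of a t x] t that by blast
  \<comment> \<open>Both sides are the maximum of \<open>k\<close> and \<open>p\<close>.\<close>
  have max_eq: "k + (p - k) = p + (k - p)" for k by simp
  have s_trn: "seq_comp C x t (p + i) d = trn X (q + i) (q + i + d)" for i d
  proof (induction d)
    case (Suc d)
    then show ?case using tX[of "i + d"] trn_comp[of "q + i" "q + i + d" "Suc (q + i + d)"]
      by (simp add: add.assoc)
  qed (simp add: xX trn_id)
  have s_max: "seq_comp C x t k (p - k) \<in> homset C (x k) (obj X (q + (k - p)))" if "k \<ge> a" for k
    using s_hom[OF that, of "p - k"] xX[of "k - p"] max_eq by metis
  have c'_hom: "c' k \<in> homset C (x k) L" if "k \<ge> a" for k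
    unfolding c'_def using comp_hom[OF s_max[OF that] c] .
  have c'_tail: "c' (p + j) = c (q + j)" for j
    using comp_id_right[OF c] by (simp add: c'_def xX)
  have c'_step: "c' (Suc k) \<cdot> t k = c' k" if k: "k \<ge> a" for k
  proof (cases "k < p")
    case True
    have rec: "seq_comp C x t k (p - k) = seq_comp C x t (Suc k) (p - Suc k) \<cdot> t k"
      using seq_comp_rec_left[of a t x k "p - Suc k"] t k Suc_diff_Suc[OF True] by simp
    have "seq_comp C x t (Suc k) (p - Suc k) \<in> homset C (x (Suc k)) (obj X q)"
      using s_max[of "Suc k"] k True by simp
    then show ?thesis
      unfolding c'_def rec
      using comp_assoc[OF t[OF k] _ c] True by simp
  next
    case False
    then obtain j where j: "k = p + j" using le_Suc_ex not_less by blast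
    show ?thesis using c'_tail[of j] c'_tail[of "Suc j"] tX[of j] ct[of "q + j" "Suc (q + j)"] j by simp
  qed
  show ?thesis
    unfolding c'_def[symmetric] is_direct_limit_def
  proof (intro conjI allI impI)
    show "direct_system C ?S" by (rule seq_system_direct) (rule t)
    show "is_cocone C ?S L c'"
      using seq_system_cocone[of a t x L c', OF t is_coconeD(1)[OF cc] c'_hom c'_step] .
    fix Z e assume Ze: "is_cocone C ?S Z e"
    have e: "e k \<in> homset C (x k) Z" if "k \<ge> a" for k
      using is_coconeD(2)[OF Ze, of k] that by (simp add: seq_system_def)
    have es: "e (k + d) \<cdot> seq_comp C x t k d = e k" if "k \<ge> a" for k d
      using is_coconeD(3)[OF Ze, of k "k + d"] that by (simp add: seq_system_def)
    have e_tail: "e (p + j) \<in> homset C (obj X (q + j)) Z" for j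
      using e[of "p + j"] p xX by simp
    \<comment> \<open>A cocone on the tail extends to all of \<open>X\<close>: an index before
      \<open>q\<close> is first moved to \<open>q\<close>.\<close>
    define e' where "e' m = e (p + (m - q)) \<cdot> trn X m (q + (m - q))" for m
    have e'_tail: "e' (q + j) = e (p + j)" for j
      using comp_id_right[OF e_tail] by (simp add: e'_def trn_id)
    have e_trn: "e (p + j) \<cdot> trn X (q + i) (q + j) = e (p + i)" if "i \<le> j" for i j
      using es[of "p + i" "j - i"] s_trn[of i "j - i"] that p by simp
    have "is_cocone C X Z e'"
      unfolding is_cocone_def
    proof (intro conjI ballI impI)
      show "Z \<in> Ob C" using is_coconeD(1)[OF Ze] .
      show "e' i \<in> homset C (obj X i) Z" for i
        unfolding e'_def using comp_hom[OF trn_hom e_tail] by simp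
      fix i j assume "leq X i j"
      then have ij: "i \<le> j" using leq by simp
      have "e' j \<cdot> trn X i j = e (p + (j - q)) \<cdot> trn X i (q + (j - q))"
        unfolding e'_def using comp_assoc[OF trn_hom trn_hom e_tail, of i j "j - q"] ij trn_comp by simp
      also have "\<dots> = e (p + (j - q)) \<cdot> (trn X (q + (i - q)) (q + (j - q)) \<cdot> trn X i (q + (i - q)))"
        using trn_comp[of i "q + (i - q)" "q + (j - q)"] ij by simp
      also have "\<dots> = (e (p + (j - q)) \<cdot> trn X (q + (i - q)) (q + (j - q))) \<cdot> trn X i (q + (i - q))"
        using comp_assoc[OF trn_hom trn_hom e_tail, of i "q + (i - q)" "j - q"] ij by simp
      also have "\<dots> = e' i" unfolding e'_def using e_trn[of "i - q" "j - q"] ij by simp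
      finally show "e' j \<cdot> trn X i j = e' i" .
    qed
    then have ex: "\<exists>!u. u \<in> homset C L Z \<and> (\<forall>m. u \<cdot> c m = e' m)"
      using lim idx unfolding is_direct_limit_def by simp
    \<comment> \<open>The two families of equations on \<open>u\<close> are equivalent, so unique
      existence transfers from \<open>X\<close>.\<close>
    have "(\<forall>m. u \<cdot> c m = e' m) \<longleftrightarrow> (\<forall>k\<in>idx ?S. u \<cdot> c' k = e k)" if u: "u \<in> homset C L Z" for u
    proof
      assume eq: "\<forall>m. u \<cdot> c m = e' m"
      have "u \<cdot> c' k = e k" if k: "k \<ge> a" for k
      proof -
        have "u \<cdot> c' k = e (k + (p - k)) \<cdot> seq_comp C x t k (p - k)"
          unfolding c'_def using comp_assoc[OF s_max[OF k] c u] eq e'_tail[of "k - p"] max_eq by metis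
        then show ?thesis using es[OF k] by simp
      qed
      then show "\<forall>k\<in>idx ?S. u \<cdot> c' k = e k" by (simp add: seq_system_def)
    next
      assume "\<forall>k\<in>idx ?S. u \<cdot> c' k = e k"
      then have "u \<cdot> c' (p + j) = e (p + j)" for j using p by (simp add: seq_system_def)
      then have eq: "u \<cdot> c (q + j) = e (p + j)" for j unfolding c'_tail .
      have "u \<cdot> c m = e' m" for m
      proof -
        have "u \<cdot> c m = u \<cdot> (c (q + (m - q)) \<cdot> trn X m (q + (m - q)))"
          using ct[of m "q + (m - q)"] by simp
        also have "\<dots> = e' m"
          unfolding e'_def using comp_assoc[OF trn_hom c u, of m "q + (m - q)"] eq by simp
        finally show ?thesis .
      qed
      then show "\<forall>m. u \<cdot> c m = e' m" by blast
    qed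
    then show "\<exists>!u. u \<in> homset C L Z \<and> (\<forall>k\<in>idx ?S. u \<cdot> c' k = e k)"
      using ex by metis
  qed
qed

end

section \<open>The satellite functor construction\<close>

lemma natural_transformation_id:
  assumes "category D" "additive_functor C D F"
  shows "natural_transformation C D F F (\<lambda>M. Id D (fob F M))"
proof -
  interpret D: category D by (rule assms(1))
  show ?thesis
    unfolding natural_transformation_def
    using D.id_hom[OF additive_functorD(1)[OF assms(2)]]
      D.comp_id_left[OF additive_functorD(3)[OF assms(2)]]
      D.comp_id_right[OF additive_functorD(3)[OF assms(2)]] by (metis (no_types, lifting))
qed

lemma natural_transformation_comp:
  assumes "category C" "category D"
    and "additive_functor C D F" "additive_functor C D G" "additive_functor C D H"
    and \<phi>: "natural_transformation C D F G \<phi>" and \<psi>: "natural_transformation C D G H \<psi>"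
  shows "natural_transformation C D F H (\<lambda>M. \<psi> M \<cdot>\<^bsub>D\<^esub> \<phi> M)"
proof -
  interpret C: category C by (rule assms(1))
  interpret D: category D by (rule assms(2))
  note p = natural_transformationD[OF \<phi>] and q = natural_transformationD[OF \<psi>]
  show ?thesis
    unfolding natural_transformation_def
  proof (intro conjI allI ballI)
    show "\<psi> M \<cdot>\<^bsub>D\<^esub> \<phi> M \<in> homset D (fob F M) (fob H M)" if "M \<in> Ob C" for M
      using D.comp_hom[OF p(1) q(1)] that by blast
    fix M N a assume a: "a \<in> homset C M N"
    note M = C.hom_ob(1)[OF a] and N = C.hom_ob(2)[OF a]
    note Fa = additive_functorD(3)[OF assms(3) a] and Ga = additive_functorD(3)[OF assms(4) a]
      and Ha = additive_functorD(3)[OF assms(5) a]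
    have "(\<psi> N \<cdot>\<^bsub>D\<^esub> \<phi> N) \<cdot>\<^bsub>D\<^esub> far F a = \<psi> N \<cdot>\<^bsub>D\<^esub> (far G a \<cdot>\<^bsub>D\<^esub> \<phi> M)"
      using D.comp_assoc[OF Fa p(1)[OF N] q(1)[OF N]] p(2)[OF a] by simp
    also have "\<dots> = far H a \<cdot>\<^bsub>D\<^esub> (\<psi> M \<cdot>\<^bsub>D\<^esub> \<phi> M)"
      by (rule D.comp_square[OF Ga q(1)[OF N] q(1)[OF M] Ha q(2)[OF a] p(1)[OF M]])
    finally show "(\<psi> N \<cdot>\<^bsub>D\<^esub> \<phi> N) \<cdot>\<^bsub>D\<^esub> far F a = far H a \<cdot>\<^bsub>D\<^esub> (\<psi> M \<cdot>\<^bsub>D\<^esub> \<phi> M)" .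
  qed
qed

text \<open>The explicit candidate for the transition from the truncation at \<open>m\<close> to the
  one at \<open>m + 1\<close>. Degree \<open>m\<close> already falls under the second case, with no
  satellite taken: the component there is \<open>delta_under\<close> itself, since the target has
  become a first satellite.\<close>

definition sat_step ::
  "('o1, 'm1) ab_cat \<Rightarrow> ('o2, 'm2) ab_cat \<Rightarrow> ('o1 \<Rightarrow> 'm1 \<times> 'm1) \<Rightarrow>
    ('o1, 'm1, 'o2, 'm2) cohfun \<Rightarrow> nat \<Rightarrow> int \<Rightarrow> 'o1 \<Rightarrow> 'm2" where
  "sat_step C D R T m k M =
     (if k > int m then Id D (fob (cfun T k) M)
      else sat_nat C D R (nat (int m - k)) (cfun T (int m)) (sat1 C D R (cfun T (int m + 1)))
             (delta_under C D R T (int m)) M)"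

lemma sat_trunc_high:
  assumes "k \<ge> int m"
  shows "cfun (sat_trunc C D R T m) k = cfun T k"
    and "conn (sat_trunc C D R T m) k = conn T k"
  using assms by (simp_all add: sat_trunc_def fun_eq_iff)

lemma sat_trunc_low:
  shows "cfun (sat_trunc C D R T m) (int m - int j) = sat C D R j (cfun T (int m))"
    and "conn (sat_trunc C D R T m) (int m - int (Suc j)) =
      sat_conn C D R (cfun T (int m)) (Suc j)"
proof -
  show "cfun (sat_trunc C D R T m) (int m - int j) = sat C D R j (cfun T (int m))"
    \<comment> \<open>For \<open>j = 0\<close> the first branch of \<open>sat_trunc\<close> applies;
      it agrees because no satellite is taken.\<close>
    by (cases j) (simp_all add: sat_trunc_def del: of_nat_Suc)
  have "nat (int m - (int m - int (Suc j))) = Suc j" by simp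
  then show "conn (sat_trunc C D R T m) (int m - int (Suc j)) =
      sat_conn C D R (cfun T (int m)) (Suc j)"
    unfolding sat_trunc_def fun_eq_iff by (simp del: of_nat_Suc)
qed

text \<open>Degree \<open>m - j\<close> lies \<open>j + 1\<close> below \<open>m + 1\<close>. The
  extra satellite is moved inside to match the target of a satellite of
  \<open>delta_under\<close>.\<close>

lemma sat_trunc_Suc_low:
  "cfun (sat_trunc C D R T (Suc m)) (int m - int j) =
    sat C D R j (sat1 C D R (cfun T (int m + 1)))"
proof -
  have *: "int (Suc m) - int (Suc j) = int m - int j" "int (Suc m) = int m + 1" by simp_all
  show ?thesis
    using sat_trunc_low(1)[of C D R T "Suc m" "Suc j"] unfolding *(1) sat_Suc_inner unfolding *(2) .
qed

locale satellite_cohfun = satellite_setting C D R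
  for C :: "('o1, 'm1) ab_cat" and D :: "('o2, 'm2) ab_cat" and R :: "'o1 \<Rightarrow> 'm1 \<times> 'm1" +
  fixes T :: "('o1, 'm1, 'o2, 'm2) cohfun"
  assumes cohomological: "cohomological_functor C D T"
begin

abbreviation "trunc m \<equiv> sat_trunc C D R T m"

section \<open>Connecting homomorphisms of \<open>T\<close> through the first satellite\<close>

lemma cfun_additive: "additive_functor C D (cfun T n)"
  using cohomological unfolding cohomological_functor_def by blast

lemma conn_hom:
  assumes "short_exact C f g"
  shows "conn T n f g \<in> homset D (fob (cfun T n) (Cod C g)) (fob (cfun T (n + 1)) (Dom C f))"
  using cohomological assms unfolding cohomological_functor_def by blast

lemma conn_comparison:
  assumes r: "short_exact_pair C r" and r': "short_exact_pair C r'"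
    and a: "a \<in> homset C (Cod C (snd r)) (Cod C (snd r'))" and h: "comparison C r a r' h"
  shows "far (cfun T (n + 1)) h \<cdot>\<^bsub>D\<^esub> conn T n (fst r) (snd r) =
    conn T n (fst r') (snd r') \<cdot>\<^bsub>D\<^esub> far (cfun T n) a"
proof -
  obtain l where "h \<in> homset C (Dom C (fst r)) (Dom C (fst r'))"
    "l \<in> homset C (Cod C (fst r)) (Cod C (fst r'))"
    "l \<cdot>\<^bsub>C\<^esub> fst r = fst r' \<cdot>\<^bsub>C\<^esub> h" "a \<cdot>\<^bsub>C\<^esub> snd r = snd r' \<cdot>\<^bsub>C\<^esub> l"
    using h unfolding comparison_def by metis
  with cohomological r r' a show ?thesis
    unfolding cohomological_functor_def by blast
qed

lemma delta_under_at:
  assumes M: "M \<in> Ob C"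
  shows "delta_under C D R T n M \<in>
      homset D (fob (cfun T n) M) (fob (sat1 C D R (cfun T (n + 1))) M)"
    and "incl (cfun T (n + 1)) M \<cdot>\<^bsub>D\<^esub> delta_under C D R T n M = conn T n (fst (R M)) (snd (R M))"
proof -
  note e = presentationD[OF M]
  let ?c = "conn T n (fst (R M)) (snd (R M))"
  have c: "?c \<in> homset D (fob (cfun T n) M) (fob (cfun T (n + 1)) (syz M))"
    using conn_hom[OF e(1)] e(2) by simp
  have "exact_at D ?c (far (cfun T (n + 1)) (fst (R M)))"
    using cohomological e(1) unfolding cohomological_functor_def by blast
  from D.exact_at_comp_zero[OF this]
  have z: "far (cfun T (n + 1)) (fst (R M)) \<cdot>\<^bsub>D\<^esub> ?c =
      Zer D (fob (cfun T n) M) (fob (cfun T (n + 1)) (cover M))"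
    using homsetD[OF c] homsetD[OF additive_functorD(3)[OF cfun_additive e(4)]] by simp
  show "delta_under C D R T n M \<in>
      homset D (fob (cfun T n) M) (fob (sat1 C D R (cfun T (n + 1))) M)"
    "incl (cfun T (n + 1)) M \<cdot>\<^bsub>D\<^esub> delta_under C D R T n M = ?c"
    using factor_sat_incl[OF cfun_additive M c z] by (simp_all add: delta_under_def)
qed

text \<open>After the kernel inclusion the square becomes naturality of the connecting homomorphism
  for the map of presentations given by \<open>syz_map\<close>.\<close>

lemma delta_under_natural:
  "natural_transformation C D (cfun T n) (sat1 C D R (cfun T (n + 1))) (delta_under C D R T n)"
  unfolding natural_transformation_def
proof (intro conjI allI ballI)
  let ?d = "delta_under C D R T n" and ?F = "cfun T (n + 1)"
  show "?d M \<in> homset D (fob (cfun T n) M) (fob (sat1 C D R ?F) M)" if "M \<in> Ob C" for M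
    by (rule delta_under_at(1)[OF that])
  fix M N a assume a: "a \<in> homset C M N"
  note M = C.hom_ob(1)[OF a] and N = C.hom_ob(2)[OF a]
  note eM = presentationD[OF M] and eN = presentationD[OF N]
  note dM = delta_under_at[OF M] and dN = delta_under_at[OF N]
  note h = syz_map_comparison[OF a]
  note s = sat1_far[OF cfun_additive[of "n + 1"] a h]
  note iM = sat_incl_hom(1)[OF cfun_additive[of "n + 1"] M]
    and iN = sat_incl_hom(1)[OF cfun_additive[of "n + 1"] N]
  note Ta = additive_functorD(3)[OF cfun_additive[of n] a]
  have hh: "syz_map C R a \<in> homset C (syz M) (syz N)" using h by (simp add: comparison_def)
  note Th = additive_functorD(3)[OF cfun_additive[of "n + 1"] hh]
  have "incl ?F N \<cdot>\<^bsub>D\<^esub> (?d N \<cdot>\<^bsub>D\<^esub> far (cfun T n) a) = conn T n (fst (R N)) (snd (R N)) \<cdot>\<^bsub>D\<^esub> far (cfun T n) a"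
    using D.comp_assoc[OF Ta dN(1) iN] dN(2) by simp
  also have "\<dots> = far ?F (syz_map C R a) \<cdot>\<^bsub>D\<^esub> (incl ?F M \<cdot>\<^bsub>D\<^esub> ?d M)"
    using conn_comparison[OF eM(1) eN(1) _ h, of n] a eM(2) eN(2) dM(2) by simp
  also have "\<dots> = incl ?F N \<cdot>\<^bsub>D\<^esub> (far (sat1 C D R ?F) a \<cdot>\<^bsub>D\<^esub> ?d M)"
    by (rule D.comp_square[OF iM Th s(1) iN s(2)[symmetric] dM(1)])
  finally show "?d N \<cdot>\<^bsub>D\<^esub> far (cfun T n) a = far (sat1 C D R ?F) a \<cdot>\<^bsub>D\<^esub> ?d M"
    using sat_incl_mono[OF cfun_additive N D.comp_hom[OF Ta dN(1)] D.comp_hom[OF dM(1) s(1)]] by simp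
qed

text \<open>Comparing the chosen presentation of \<open>Cod C g\<close> with the given sequence over
  the identity reduces every connecting homomorphism to that of the presentation. This is the square
  a step morphism needs in degree \<open>m\<close>.\<close>

lemma conn_factor:
  assumes e: "short_exact C f g"
  shows "conn T n f g = sat_conn C D R (cfun T (n + 1)) (Suc 0) f g \<cdot>\<^bsub>D\<^esub> delta_under C D R T n (Cod C g)"
proof -
  obtain h where h: "comparison C (R (Cod C g)) (Id C (Cod C g)) (f, g) h"
    "h \<in> homset C (syz (Cod C g)) (Dom C f)" using connecting_comparison[OF e] .
  let ?M = "Cod C g" and ?F = "cfun T (n + 1)"
  have M: "?M \<in> Ob C" using C.hom_ob C.short_exact_hom(2)[OF e] by blast
  note eM = presentationD[OF M] and d = delta_under_at[OF M, of n]
  have "conn T n f g = conn T n f g \<cdot>\<^bsub>D\<^esub> far (cfun T n) (Id C ?M)"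
    using additive_functorD(2)[OF cfun_additive M] D.comp_id_right[OF conn_hom[OF e]] by simp
  also have "\<dots> = far ?F h \<cdot>\<^bsub>D\<^esub> (incl ?F ?M \<cdot>\<^bsub>D\<^esub> delta_under C D R T n ?M)"
    using conn_comparison[OF eM(1) _ _ h(1), of n] e eM(2) C.id_hom[OF M] d(2) by simp
  also have "\<dots> = (far ?F h \<cdot>\<^bsub>D\<^esub> incl ?F ?M) \<cdot>\<^bsub>D\<^esub> delta_under C D R T n ?M"
    by (rule D.comp_assoc[OF d(1) sat_incl_hom(1)[OF cfun_additive M]
          additive_functorD(3)[OF cfun_additive h(2)]])
  finally show ?thesis using sat_conn_eq[OF cfun_additive e h(1), of "n + 1" 0] by simp
qed

section \<open>Truncated functors and the morphisms between them\<close>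

lemma trunc_additive: "additive_functor C D (cfun (trunc m) k)"
  by (simp add: sat_trunc_def cfun_additive sat_additive)

lemma trunc_conn_hom:
  assumes e: "short_exact C f g"
  shows "conn (trunc m) k f g \<in>
    homset D (fob (cfun (trunc m) k) (Cod C g)) (fob (cfun (trunc m) (k + 1)) (Dom C f))"
proof (cases "k \<ge> int m")
  case True
  then show ?thesis using conn_hom[OF e] by (simp add: sat_trunc_high)
next
  case False
  define j where "j = nat (int m - k - 1)"
  have k: "k = int m - int (Suc j)" "k + 1 = int m - int j" using False by (simp_all add: j_def)
  show ?thesis
    unfolding k(2) unfolding k(1) sat_trunc_low using sat_conn_hom[OF cfun_additive e] .
qed

lemma sat_step_natural:
  "natural_transformation C D (cfun (trunc m) k) (cfun (trunc (Suc m)) k) (sat_step C D R T m k)"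
proof (cases "k > int m")
  case True
  then have "cfun (trunc m) k = cfun T k" "cfun (trunc (Suc m)) k = cfun T k"
    "sat_step C D R T m k = (\<lambda>M. Id D (fob (cfun T k) M))"
    by (simp_all add: sat_trunc_high sat_step_def fun_eq_iff)
  then show ?thesis using natural_transformation_id[OF D.category_axioms cfun_additive] by simp
next
  case False
  define j where "j = nat (int m - k)"
  have k: "k = int m - int j" using False by (simp add: j_def)
  have s: "sat_step C D R T m k = sat_nat C D R j (cfun T (int m))
      (sat1 C D R (cfun T (int m + 1))) (delta_under C D R T (int m))"
    using False by (simp add: sat_step_def fun_eq_iff j_def)
  show ?thesis
    unfolding s unfolding k sat_trunc_low(1) sat_trunc_Suc_low
    by (rule sat_nat_natural[OF cfun_additive sat1_additive[OF cfun_additive] delta_under_natural])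
qed

lemma sat_step_morphism: "cohfun_morphism C D (trunc m) (trunc (Suc m)) (sat_step C D R T m)"
  unfolding cohfun_morphism_def
proof (intro conjI allI impI)
  fix k
  show "natural_transformation C D (cfun (trunc m) k) (cfun (trunc (Suc m)) k) (sat_step C D R T m k)"
    by (rule sat_step_natural)
  fix f g assume e: "short_exact C f g"
  let ?s = "sat_step C D R T m" and ?G = "sat1 C D R (cfun T (int m + 1))"
  \<comment> \<open>Above \<open>m\<close> the components are identities; in degree \<open>m\<close>
    the square is the factorization of the connecting homomorphism; below, it is naturality of
    \<open>\<epsilon>\<close> in the functor.\<close>
  consider "k > int m" | "k = int m" | j where "k = int m - int (Suc j)"
    using that(3)[of "nat (int m - k - 1)"] by force
  then show "?s (k + 1) (Dom C f) \<cdot>\<^bsub>D\<^esub> conn (trunc m) k f g = conn (trunc (Suc m)) k f g \<cdot>\<^bsub>D\<^esub> ?s k (Cod C g)"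
  proof cases
    case 1
    then show ?thesis
      using D.comp_id_left[OF conn_hom[OF e]] D.comp_id_right[OF conn_hom[OF e]]
      by (simp add: sat_step_def sat_trunc_high)
  next
    case 2
    have c: "conn (trunc (Suc m)) (int m) = sat_conn C D R (cfun T (int m + 1)) (Suc 0)"
      using sat_trunc_low(2)[of C D R T "Suc m" 0] by (simp add: add.commute)
    show ?thesis
      using 2 c conn_factor[OF e, of "int m", symmetric] D.comp_id_left[OF conn_hom[OF e]]
      by (simp add: sat_step_def sat_trunc_high)
  next
    case (3 j)
    \<comment> \<open>Counted from \<open>m + 1\<close> the degree is one satellite deeper; that
      satellite is absorbed into \<open>?G\<close>.\<close>
    have k1: "k + 1 = int m - int j" and kS: "int m - int (Suc j) = int (Suc m) - int (Suc (Suc j))"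
      and Sm: "int (Suc m) = int m + 1" using 3 by simp_all
    have s1: "?s (int m - int j) = sat_nat C D R j (cfun T (int m)) ?G (delta_under C D R T (int m))" for j
      by (simp add: sat_step_def fun_eq_iff)
    have c: "conn (trunc (Suc m)) (int m - int (Suc j)) f g = sat_conn C D R ?G (Suc j) f g"
      unfolding kS sat_trunc_low(2) sat_conn_Suc_inner unfolding Sm ..
    show ?thesis
      unfolding k1 unfolding 3 s1 c sat_trunc_low(2)
      by (rule sat_conn_natural[OF cfun_additive sat1_additive[OF cfun_additive] delta_under_natural e])
  qed
qed

lemma trunc_morphism_id: "cohfun_morphism C D (trunc m) (trunc m) (\<lambda>k M. Id D (fob (cfun (trunc m) k) M))"
  unfolding cohfun_morphism_def
  using natural_transformation_id[OF D.category_axioms trunc_additive]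
    D.comp_id_left[OF trunc_conn_hom] D.comp_id_right[OF trunc_conn_hom] by simp

lemma trunc_morphism_comp:
  assumes \<Phi>: "cohfun_morphism C D (trunc m) (trunc m') \<Phi>"
    and \<Psi>: "cohfun_morphism C D (trunc m') (trunc m'') \<Psi>"
  shows "cohfun_morphism C D (trunc m) (trunc m'') (\<lambda>k M. \<Psi> k M \<cdot>\<^bsub>D\<^esub> \<Phi> k M)"
  unfolding cohfun_morphism_def
proof (intro conjI allI impI)
  have n: "natural_transformation C D (cfun (trunc m) k) (cfun (trunc m') k) (\<Phi> k)"
    "natural_transformation C D (cfun (trunc m') k) (cfun (trunc m'') k) (\<Psi> k)" for k
    using \<Phi> \<Psi> unfolding cohfun_morphism_def by blast+
  fix k
  show "natural_transformation C D (cfun (trunc m) k) (cfun (trunc m'') k) (\<lambda>M. \<Psi> k M \<cdot>\<^bsub>D\<^esub> \<Phi> k M)"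
    by (rule natural_transformation_comp[OF C.category_axioms D.category_axioms
          trunc_additive trunc_additive trunc_additive n])
  fix f g assume e: "short_exact C f g"
  have A: "Dom C f \<in> Ob C" and B: "Cod C g \<in> Ob C"
    using C.hom_ob C.short_exact_hom(1,2)[OF e] by blast+
  note a = natural_transformationD(1)[OF n(1)[of "k + 1"] A]
      natural_transformationD(1)[OF n(2)[of "k + 1"] A]
    and b = natural_transformationD(1)[OF n(1)[of k] B] natural_transformationD(1)[OF n(2)[of k] B]
  note c = trunc_conn_hom[OF e, where k = k]
  have \<Phi>c: "\<Phi> (k + 1) (Dom C f) \<cdot>\<^bsub>D\<^esub> conn (trunc m) k f g = conn (trunc m') k f g \<cdot>\<^bsub>D\<^esub> \<Phi> k (Cod C g)"
    and \<Psi>c: "\<Psi> (k + 1) (Dom C f) \<cdot>\<^bsub>D\<^esub> conn (trunc m') k f g = conn (trunc m'') k f g \<cdot>\<^bsub>D\<^esub> \<Psi> k (Cod C g)"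
    using \<Phi> \<Psi> e unfolding cohfun_morphism_def by blast+
  have "(\<Psi> (k + 1) (Dom C f) \<cdot>\<^bsub>D\<^esub> \<Phi> (k + 1) (Dom C f)) \<cdot>\<^bsub>D\<^esub> conn (trunc m) k f g =
      \<Psi> (k + 1) (Dom C f) \<cdot>\<^bsub>D\<^esub> (conn (trunc m') k f g \<cdot>\<^bsub>D\<^esub> \<Phi> k (Cod C g))"
    using D.comp_assoc[OF c a] \<Phi>c by metis
  also have "\<dots> = conn (trunc m'') k f g \<cdot>\<^bsub>D\<^esub> (\<Psi> k (Cod C g) \<cdot>\<^bsub>D\<^esub> \<Phi> k (Cod C g))"
    by (rule D.comp_square[OF c a(2) b(2) c \<Psi>c b(1)])
  finally show "(\<Psi> (k + 1) (Dom C f) \<cdot>\<^bsub>D\<^esub> \<Phi> (k + 1) (Dom C f)) \<cdot>\<^bsub>D\<^esub> conn (trunc m) k f g =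
      conn (trunc m'') k f g \<cdot>\<^bsub>D\<^esub> (\<Psi> k (Cod C g) \<cdot>\<^bsub>D\<^esub> \<Phi> k (Cod C g))" .
qed

text \<open>
  Below degree \<open>m'\<close> the connecting map of a chosen presentation in the target is a monomorphism,
  so a morphism is determined by descending induction on the degree.
\<close>

lemma trunc_morphism_unique:
  assumes \<Phi>: "cohfun_morphism C D (trunc m) (trunc m') \<Phi>"
    and \<Psi>: "cohfun_morphism C D (trunc m) (trunc m') \<Psi>"
    and eq: "\<And>k M. k \<ge> int m' \<Longrightarrow> M \<in> Ob C \<Longrightarrow> \<Phi> k M = \<Psi> k M" and M: "M \<in> Ob C"
  shows "\<Phi> k M = \<Psi> k M"
proof -
  have n: "natural_transformation C D (cfun (trunc m) k) (cfun (trunc m') k) (\<Phi> k)"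
    "natural_transformation C D (cfun (trunc m) k) (cfun (trunc m') k) (\<Psi> k)" for k
    using \<Phi> \<Psi> unfolding cohfun_morphism_def by blast+
  have low: "\<Phi> (int m' - int j) M = \<Psi> (int m' - int j) M" if "M \<in> Ob C" for j M
    using that
  \<comment> \<open>The object has to vary: the component at \<open>M\<close> is compared with the
    one a degree higher at the syzygy of \<open>M\<close>.\<close>
  proof (induction j arbitrary: M)
    case 0
    then show ?case using eq by simp
  next
    case (Suc j)
    let ?k = "int m' - int (Suc j)" and ?r = "R M" and ?F = "cfun T (int m')"
    note e = presentationD[OF Suc.prems]
    have k1: "?k + 1 = int m' - int j" by simp
    have c: "conn (trunc m') ?k (fst ?r) (snd ?r) = incl (sat C D R j ?F) M"
      unfolding sat_trunc_low(2) by (rule sat_conn_presentation[OF cfun_additive Suc.prems])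
    have "\<Phi> (?k + 1) (syz M) \<cdot>\<^bsub>D\<^esub> conn (trunc m) ?k (fst ?r) (snd ?r) =
        conn (trunc m') ?k (fst ?r) (snd ?r) \<cdot>\<^bsub>D\<^esub> \<Phi> ?k (Cod C (snd ?r))"
      "\<Psi> (?k + 1) (syz M) \<cdot>\<^bsub>D\<^esub> conn (trunc m) ?k (fst ?r) (snd ?r) =
        conn (trunc m') ?k (fst ?r) (snd ?r) \<cdot>\<^bsub>D\<^esub> \<Psi> ?k (Cod C (snd ?r))"
      using \<Phi> \<Psi> e(1) unfolding cohfun_morphism_def by blast+
    then have "incl (sat C D R j ?F) M \<cdot>\<^bsub>D\<^esub> \<Phi> ?k M = incl (sat C D R j ?F) M \<cdot>\<^bsub>D\<^esub> \<Psi> ?k M"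
      unfolding k1 Suc.IH[OF e(6)] c e(2) by simp
    moreover have "\<Phi> ?k M \<in> homset D (fob (cfun (trunc m) ?k) M) (fob (sat1 C D R (sat C D R j ?F)) M)"
      "\<Psi> ?k M \<in> homset D (fob (cfun (trunc m) ?k) M) (fob (sat1 C D R (sat C D R j ?F)) M)"
      using natural_transformationD(1)[OF n(1) Suc.prems, of ?k]
        natural_transformationD(1)[OF n(2) Suc.prems, of ?k]
      unfolding sat_trunc_low(1)[of _ _ _ _ m' "Suc j"] by simp_all
    ultimately show ?case using sat_incl_mono[OF sat_additive[OF cfun_additive] Suc.prems] by blast
  qed
  show ?thesis
    using eq[OF _ M, of k] low[OF M, of "nat (int m' - k)"] by (cases "k \<ge> int m'") simp_all
qed

text \<open>The witness is the composite of step morphisms; the step out of \<open>m'\<close> is the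
  identity in all degrees above \<open>m'\<close>.\<close>

lemma trunc_morphism_exists:
  assumes "m \<le> m'"
  shows "\<exists>\<Phi>. cohfun_morphism C D (trunc m) (trunc m') \<Phi> \<and>
    (\<forall>k\<ge>int m'. \<forall>M\<in>Ob C. \<Phi> k M = Id D (fob (cfun T k) M))"
  using assms
proof (induction rule: dec_induct)
  case base
  show ?case using trunc_morphism_id[of m] by (auto simp: sat_trunc_high)
next
  case (step m')
  then obtain \<Phi> where \<Phi>: "cohfun_morphism C D (trunc m) (trunc m') \<Phi>"
    "\<And>k M. k \<ge> int m' \<Longrightarrow> M \<in> Ob C \<Longrightarrow> \<Phi> k M = Id D (fob (cfun T k) M)" by blast
  have "sat_step C D R T m' k M \<cdot>\<^bsub>D\<^esub> \<Phi> k M = Id D (fob (cfun T k) M)"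
    if "k \<ge> int (Suc m')" "M \<in> Ob C" for k M
    using that \<Phi>(2)[of k M] D.comp_id_left[OF D.id_hom[OF additive_functorD(1)[OF cfun_additive]]]
    by (simp add: sat_step_def)
  then show ?case using trunc_morphism_comp[OF \<Phi>(1) sat_step_morphism] by blast
qed

section \<open>Transitions of the limit system\<close>

lemma sat_trans_morphism:
  assumes "m \<le> m'"
  shows "cohfun_morphism C D (trunc m) (trunc m') (sat_trans C D R T m m')"
    and "k \<ge> int m' \<Longrightarrow> M \<in> Ob C \<Longrightarrow> sat_trans C D R T m m' k M = Id D (fob (cfun T k) M)"
  using someI_ex[OF trunc_morphism_exists[OF assms]] unfolding sat_trans_def by blast+

text \<open>\<open>sat_trans\<close> is only a choice; this lets any explicit morphism with the
  right high degrees compute it.\<close>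

lemma sat_trans_unique:
  assumes "m \<le> m'" and "cohfun_morphism C D (trunc m) (trunc m') \<Phi>"
    and "\<And>k M. k \<ge> int m' \<Longrightarrow> M \<in> Ob C \<Longrightarrow> \<Phi> k M = Id D (fob (cfun T k) M)" and "M \<in> Ob C"
  shows "sat_trans C D R T m m' k M = \<Phi> k M"
  using trunc_morphism_unique[OF sat_trans_morphism(1)[OF assms(1)] assms(2) _ assms(4)]
    sat_trans_morphism(2)[OF assms(1)] assms(3) by simp

lemma sat_trans_hom:
  assumes "m \<le> m'" "M \<in> Ob C"
  shows "sat_trans C D R T m m' k M \<in> homset D (fob (cfun (trunc m) k) M) (fob (cfun (trunc m') k) M)"
proof (rule natural_transformationD(1)[OF _ assms(2)])
  show "natural_transformation C D (cfun (trunc m) k) (cfun (trunc m') k) (sat_trans C D R T m m' k)"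
    using sat_trans_morphism(1)[OF assms(1)] unfolding cohfun_morphism_def by blast
qed

lemma sat_trans_step:
  assumes "M \<in> Ob C"
  shows "sat_trans C D R T m (Suc m) k M = sat_step C D R T m k M"
  using sat_trans_unique[OF _ sat_step_morphism _ assms] by (simp add: sat_step_def)

lemma hat_system_direct:
  assumes M: "M \<in> Ob C"
  shows "direct_system D (hat_system C D R T n M)"
  unfolding direct_system_def hat_system_def dsys.simps
proof (intro conjI ballI impI)
  show "directed_set (UNIV :: nat set) (\<le>)"
    unfolding directed_set_def by (auto intro: max.cobounded1 max.cobounded2)
  fix i :: nat
  show ob: "fob (cfun (trunc i) n) M \<in> Ob D" by (rule additive_functorD(1)[OF trunc_additive M])
  show "sat_trans C D R T i i n M = Id D (fob (cfun (trunc i) n) M)"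
    using sat_trans_unique[OF order_refl trunc_morphism_id _ M] by (simp add: sat_trunc_high)
  fix j :: nat assume ij: "i \<le> j"
  show "sat_trans C D R T i j n M \<in> homset D (fob (cfun (trunc i) n) M) (fob (cfun (trunc j) n) M)"
    by (rule sat_trans_hom[OF ij M])
  fix k :: nat assume jk: "j \<le> k"
  \<comment> \<open>A composite of transitions is the identity in degrees from \<open>k\<close> on,
    so uniqueness makes it the direct transition.\<close>
  have "sat_trans C D R T j k n M \<cdot>\<^bsub>D\<^esub> sat_trans C D R T i j n M = Id D (fob (cfun T n) M)"
    if "n \<ge> int k" "M \<in> Ob C" for n M
    using that ij jk sat_trans_morphism(2)[OF ij _ that(2), of n] sat_trans_morphism(2)[OF jk _ that(2), of n]
      D.comp_id_left[OF D.id_hom[OF additive_functorD(1)[OF cfun_additive that(2)]]] by simp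
  then show "sat_trans C D R T j k n M \<cdot>\<^bsub>D\<^esub> sat_trans C D R T i j n M = sat_trans C D R T i k n M"
    using sat_trans_unique[OF order_trans[OF ij jk] trunc_morphism_comp[OF
          sat_trans_morphism(1)[OF ij] sat_trans_morphism(1)[OF jk]] _ M, of n] by simp
qed

lemma hat_conn_morphism:
  assumes e: "short_exact C f g"
  shows "dsys_morphism D (hat_system C D R T n (Cod C g)) (hat_system C D R T (n + 1) (Dom C f))
    (\<lambda>m. conn (trunc m) n f g)"
proof -
  have A: "Dom C f \<in> Ob C" and B: "Cod C g \<in> Ob C"
    using C.hom_ob C.short_exact_hom(1,2)[OF e] by blast+
  have "sat_trans C D R T i j (n + 1) (Dom C f) \<cdot>\<^bsub>D\<^esub> conn (trunc i) n f g =
      conn (trunc j) n f g \<cdot>\<^bsub>D\<^esub> sat_trans C D R T i j n (Cod C g)" if "i \<le> j" for i j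
    using sat_trans_morphism(1)[OF that] e unfolding cohfun_morphism_def by blast
  then show ?thesis
    unfolding dsys_morphism_def
  proof (intro conjI ballI impI)
    show "direct_system D (hat_system C D R T n (Cod C g))" by (rule hat_system_direct[OF B])
    show "direct_system D (hat_system C D R T (n + 1) (Dom C f))" by (rule hat_system_direct[OF A])
  qed (simp_all add: hat_system_def trunc_conn_hom[OF e])
qed

end

section \<open>The satellite systems against the limit system\<close>

context satellite_cohfun
begin

lemma sat_delta_under_hom:
  assumes "M \<in> Ob C"
  shows "sat_nat C D R k (cfun T i) (sat1 C D R (cfun T (i + 1))) (delta_under C D R T i) M \<in>
    homset D (fob (sat C D R k (cfun T i)) M) (fob (sat C D R (Suc k) (cfun T (i + 1))) M)"
  unfolding sat_Suc_inner
  by (rule natural_transformationD(1)[OF sat_nat_natural[OF cfun_additive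
        sat1_additive[OF cfun_additive] delta_under_natural] assms])

text \<open>
  With \<open>d = 0\<close> this is the source system of the connecting homomorphism, with \<open>d = 1\<close> its target
  system; \<open>p\<close> is the first index \<open>k \<ge> 1\<close> for which \<open>n + k\<close> is the index of a term of the system
  defining the satellite functor construction.
\<close>

lemma hat_limit_satellites:
  assumes M: "M \<in> Ob C"
    and lim: "is_direct_limit D (hat_system C D R T (n + int d) M) L c"
    and d: "d \<le> 1" and p: "p \<ge> 1" and q: "int q = n + int p"
  shows "is_direct_limit D
    (seq_system D {1..} (\<lambda>k. fob (sat C D R (k - d) (cfun T (n + int k))) M)
      (\<lambda>k. sat_nat C D R (k - d) (cfun T (n + int k)) (sat1 C D R (cfun T (n + int k + 1)))
         (delta_under C D R T (n + int k)) M)) L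
    (\<lambda>k. c (q + (k - p)) \<cdot>\<^bsub>D\<^esub> seq_comp D (\<lambda>k. fob (sat C D R (k - d) (cfun T (n + int k))) M)
      (\<lambda>k. sat_nat C D R (k - d) (cfun T (n + int k)) (sat1 C D R (cfun T (n + int k + 1)))
         (delta_under C D R T (n + int k)) M) k (p - k))"
proof (rule D.direct_limit_tail[OF lim])
  show "idx (hat_system C D R T (n + int d) M) = UNIV" "leq (hat_system C D R T (n + int d) M) = (\<le>)"
    by (simp_all add: hat_system_def)
  show "sat_nat C D R (k - d) (cfun T (n + int k)) (sat1 C D R (cfun T (n + int k + 1)))
      (delta_under C D R T (n + int k)) M \<in>
    homset D (fob (sat C D R (k - d) (cfun T (n + int k))) M)
      (fob (sat C D R (Suc k - d) (cfun T (n + int (Suc k)))) M)" if "k \<ge> 1" for k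
  proof -
    \<comment> \<open>For \<open>d \<le> 1\<close> and \<open>k \<ge> 1\<close> the truncated
      difference \<open>k - d\<close> is a true one, so one more step adds one more
      satellite.\<close>
    have "Suc k - d = Suc (k - d)" "n + int (Suc k) = n + int k + 1" using d that by simp_all
    then show ?thesis using sat_delta_under_hom[OF M, of "k - d" "n + int k"] by metis
  qed
  show "p \<ge> 1" by (rule p)
  fix j
  \<comment> \<open>Index \<open>p + j\<close> corresponds to the truncation at
    \<open>q + j\<close>, and degree \<open>n + d\<close> lies \<open>p + j - d\<close> below
    it.\<close>
  have deg: "n + int d = int (q + j) - int (p + j - d)" "n + int (p + j) = int (q + j)"
    using d p q by simp_all
  have nat_deg: "nat (int (q + j) - (int (q + j) - int (p + j - d))) = p + j - d" by simp
  show "fob (sat C D R (p + j - d) (cfun T (n + int (p + j)))) M =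
      obj (hat_system C D R T (n + int d) M) (q + j)"
    unfolding hat_system_def dsys.simps deg sat_trunc_low ..
  show "sat_nat C D R (p + j - d) (cfun T (n + int (p + j))) (sat1 C D R (cfun T (n + int (p + j) + 1)))
      (delta_under C D R T (n + int (p + j))) M =
    trn (hat_system C D R T (n + int d) M) (q + j) (Suc (q + j))"
    unfolding hat_system_def dsys.simps sat_trans_step[OF M] sat_step_def deg nat_deg by simp
qed

text \<open>Each square is naturality of \<open>\<epsilon>\<close> with respect to
  \<open>delta_under\<close> in degree \<open>n + k\<close>; the satellite in the target of
  \<open>delta_under\<close> accounts for the step from \<open>k\<close> to
  \<open>k + 1\<close>.\<close>

lemma satellite_conn_morphism:
  assumes e: "short_exact C f g"
  shows "dsys_morphism D (conn_source_system C D R T n (Cod C g)) (conn_target_system C D R T n (Dom C f))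
    (\<lambda>k. sat_conn C D R (cfun T (n + int k)) k f g)"
  unfolding conn_source_system_def conn_target_system_def
proof (rule D.seq_system_morphism)
  have A: "Dom C f \<in> Ob C" and B: "Cod C g \<in> Ob C"
    using C.hom_ob C.short_exact_hom(1,2)[OF e] by blast+
  fix k :: nat assume "k \<ge> 1"
  then obtain j where k: "k = Suc j" using not0_implies_Suc by force
  have Sk: "n + int (Suc k) = n + int k + 1" by simp
  have pred: "k - 1 = j" "Suc k - 1 = Suc j" using k by simp_all
  show "sat_nat C D R k (cfun T (n + int k)) (sat1 C D R (cfun T (n + int k + 1)))
      (delta_under C D R T (n + int k)) (Cod C g) \<in>
    homset D (fob (sat C D R k (cfun T (n + int k))) (Cod C g))
      (fob (sat C D R (Suc k) (cfun T (n + int (Suc k)))) (Cod C g))"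
    unfolding Sk by (rule sat_delta_under_hom[OF B])
  show "sat_nat C D R (k - 1) (cfun T (n + int k)) (sat1 C D R (cfun T (n + int k + 1)))
      (delta_under C D R T (n + int k)) (Dom C f) \<in>
    homset D (fob (sat C D R (k - 1) (cfun T (n + int k))) (Dom C f))
      (fob (sat C D R (Suc k - 1) (cfun T (n + int (Suc k)))) (Dom C f))"
    unfolding Sk pred by (rule sat_delta_under_hom[OF A])
  show "sat_conn C D R (cfun T (n + int k)) k f g \<in>
    homset D (fob (sat C D R k (cfun T (n + int k))) (Cod C g))
      (fob (sat C D R (k - 1) (cfun T (n + int k))) (Dom C f))"
    using sat_conn_hom[OF cfun_additive e, of "n + int k" j] unfolding k by simp
  show "sat_nat C D R (k - 1) (cfun T (n + int k)) (sat1 C D R (cfun T (n + int k + 1)))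
      (delta_under C D R T (n + int k)) (Dom C f) \<cdot>\<^bsub>D\<^esub> sat_conn C D R (cfun T (n + int k)) k f g =
    sat_conn C D R (cfun T (n + int (Suc k))) (Suc k) f g \<cdot>\<^bsub>D\<^esub>
      sat_nat C D R k (cfun T (n + int k)) (sat1 C D R (cfun T (n + int k + 1)))
        (delta_under C D R T (n + int k)) (Cod C g)"
    using sat_conn_natural[OF cfun_additive sat1_additive[OF cfun_additive] delta_under_natural e,
        of j "n + int k"]
    unfolding Sk unfolding k sat_conn_Suc_inner diff_Suc_1 .
qed

text \<open>From a suitable index on, the maps \<open>\<epsilon>\<close> are literally the
  connecting homomorphisms of the truncations, whose limit is the map in question; earlier indices
  are first moved to that one.\<close>

lemma hat_conn_limit:
  assumes dlim: "has_exact_direct_limits TYPE('i::infinite) D" and e: "short_exact C f g"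
  shows "\<exists>c d. (\<forall>k\<ge>1. n + int k \<ge> 0 \<longrightarrow>
       c k = hat_leg C D R T n (Cod C g) (nat (n + int k)) \<and>
       d k = hat_leg C D R T (n + 1) (Dom C f) (nat (n + int k))) \<and>
    is_direct_limit_map D
      (conn_source_system C D R T n (Cod C g)) (fob (cfun (hat_cohfun C D R T) n) (Cod C g)) c
      (conn_target_system C D R T n (Dom C f)) (fob (cfun (hat_cohfun C D R T) (n + 1)) (Dom C f)) d
      (\<lambda>k. sat_conn C D R (cfun T (n + int k)) k f g) (conn (hat_cohfun C D R T) n f g)"
proof -
  let ?B = "Cod C g" and ?A = "Dom C f" and ?u = "conn (hat_cohfun C D R T) n f g"
  have A: "?A \<in> Ob C" and B: "?B \<in> Ob C"
    using C.hom_ob C.short_exact_hom(1,2)[OF e] by blast+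
  define x where "x k = fob (sat C D R k (cfun T (n + int k))) ?B" for k
  define y where "y k = fob (sat C D R (k - 1) (cfun T (n + int k))) ?A" for k
  define s where "s k = sat_nat C D R k (cfun T (n + int k)) (sat1 C D R (cfun T (n + int k + 1)))
    (delta_under C D R T (n + int k)) ?B" for k
  define t where "t k = sat_nat C D R (k - 1) (cfun T (n + int k)) (sat1 C D R (cfun T (n + int k + 1)))
    (delta_under C D R T (n + int k)) ?A" for k
  define \<epsilon> where "\<epsilon> k = sat_conn C D R (cfun T (n + int k)) k f g" for k
  \<comment> \<open>The least \<open>k \<ge> 1\<close> with \<open>n + k \<ge> 0\<close>; for
    negative \<open>n\<close> it makes \<open>q\<close> zero.\<close>
  define p where "p = (if n \<ge> 0 then 1 else nat (- n))"
  define q where "q = nat (n + int p)"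
  have p: "p \<ge> 1" and q: "int q = n + int p" by (simp_all add: p_def q_def Suc_le_eq)
  let ?X = "hat_system C D R T n ?B" and ?Y = "hat_system C D R T (n + 1) ?A"
  note lX = nat_direct_limit_exists[OF dlim hat_system_direct[OF B, of n]]
    and lY = nat_direct_limit_exists[OF dlim hat_system_direct[OF A, of "n + 1"]]
  have hat: "is_direct_limit_map D ?X (fst (dlim D ?X)) (snd (dlim D ?X))
      ?Y (fst (dlim D ?Y)) (snd (dlim D ?Y)) (\<lambda>m. conn (trunc m) n f g) ?u"
    using D.dlim_map_is_direct_limit_map[OF lX lY hat_conn_morphism[OF e]]
    by (simp add: hat_cohfun_def)
  let ?L = "fst (dlim D ?X)" and ?L' = "fst (dlim D ?Y)"
  let ?l = "hat_leg C D R T n ?B" and ?l' = "hat_leg C D R T (n + 1) ?A"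
  have limX: "is_direct_limit D ?X ?L ?l" and limY: "is_direct_limit D ?Y ?L' ?l'"
    and u: "?u \<in> homset D ?L ?L'" and ul: "?u \<cdot>\<^bsub>D\<^esub> ?l m = ?l' m \<cdot>\<^bsub>D\<^esub> conn (trunc m) n f g" for m
    using hat by (simp_all add: is_direct_limit_map_def hat_leg_def[abs_def] hat_system_def)
  define c where "c k = ?l (q + (k - p)) \<cdot>\<^bsub>D\<^esub> seq_comp D x s k (p - k)" for k
  define d where "d k = ?l' (q + (k - p)) \<cdot>\<^bsub>D\<^esub> seq_comp D y t k (p - k)" for k
  have S: "conn_source_system C D R T n ?B = seq_system D {1..} x s"
    unfolding conn_source_system_def x_def s_def ..
  have T: "conn_target_system C D R T n ?A = seq_system D {1..} y t"
    unfolding conn_target_system_def y_def t_def ..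
  have limS: "is_direct_limit D (seq_system D {1..} x s) ?L c"
    using hat_limit_satellites[OF B _ _ p q, of 0 ?L ?l] limX
    unfolding c_def[abs_def] x_def[abs_def] s_def[abs_def] by simp
  have limT: "is_direct_limit D (seq_system D {1..} y t) ?L' d"
    using hat_limit_satellites[OF A _ _ p q, of 1 ?L' ?l'] limY
    unfolding d_def[abs_def] y_def[abs_def] t_def[abs_def] by simp
  have mor: "dsys_morphism D (seq_system D {1..} x s) (seq_system D {1..} y t) \<epsilon>"
    using satellite_conn_morphism[OF e, of n] unfolding S T \<epsilon>_def[abs_def] .
  have eps: "\<epsilon> k \<in> homset D (x k) (y k)" if "k \<ge> 1" for k
    using mor that by (simp add: dsys_morphism_def seq_system_def)
  have seps: "seq_comp D y t k i \<cdot>\<^bsub>D\<^esub> \<epsilon> k = \<epsilon> (k + i) \<cdot>\<^bsub>D\<^esub> seq_comp D x s k i" if "k \<ge> 1" for k i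
  proof -
    have "\<forall>i\<in>{1..}. \<forall>j\<in>{1..}. i \<le> j \<longrightarrow>
        seq_comp D y t i (j - i) \<cdot>\<^bsub>D\<^esub> \<epsilon> i = \<epsilon> j \<cdot>\<^bsub>D\<^esub> seq_comp D x s i (j - i)"
      using mor unfolding dsys_morphism_def seq_system_def by simp
    from this[THEN bspec, THEN bspec, of k "k + i"] that show ?thesis by simp
  qed
  have s_hom: "seq_comp D x s k i \<in> homset D (x k) (x (k + i))" if "k \<ge> 1" for k i
    using direct_systemD(3)[of D "seq_system D {1..} x s" k "k + i"] limS that
    by (simp add: is_direct_limit_def seq_system_def)
  have t_hom: "seq_comp D y t k i \<in> homset D (y k) (y (k + i))" if "k \<ge> 1" for k i
    using direct_systemD(3)[of D "seq_system D {1..} y t" k "k + i"] limT that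
    by (simp add: is_direct_limit_def seq_system_def)
  have tail: "c (p + j) = ?l (q + j)" "d (p + j) = ?l' (q + j)"
    "\<epsilon> (p + j) = conn (trunc (q + j)) n f g"
    "?l (q + j) \<in> homset D (x (p + j)) ?L" "?l' (q + j) \<in> homset D (y (p + j)) ?L'" for j
  proof -
    obtain i where i: "p + j = Suc i" using p by (cases "p + j") simp_all
    have deg: "n + int (p + j) = int (q + j)" "n = int (q + j) - int (Suc i)" "n + 1 = int (q + j) - int i"
      using q i by simp_all
    have xX: "x (p + j) = obj ?X (q + j)" and yY: "y (p + j) = obj ?Y (q + j)"
      unfolding x_def y_def deg(1) unfolding i diff_Suc_1 hat_system_def dsys.simps
      using sat_trunc_low(1)[of C D R T "q + j" "Suc i"] sat_trunc_low(1)[of C D R T "q + j" i]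
      unfolding deg(2)[symmetric] deg(3)[symmetric] by simp_all
    show l: "?l (q + j) \<in> homset D (x (p + j)) ?L" and l': "?l' (q + j) \<in> homset D (y (p + j)) ?L'"
      using limX limY unfolding is_direct_limit_def is_cocone_def xX yY
      by (simp_all add: hat_system_def)
    show "c (p + j) = ?l (q + j)" "d (p + j) = ?l' (q + j)"
      using D.comp_id_right[OF l] D.comp_id_right[OF l'] by (simp_all add: c_def d_def)
    show "\<epsilon> (p + j) = conn (trunc (q + j)) n f g"
      using sat_trunc_low(2)[of C D R T "q + j" i] unfolding \<epsilon>_def deg(1) unfolding i deg(2)[symmetric]
      by simp
  qed
  \<comment> \<open>The leg at \<open>k\<close> passes through the maximum of \<open>k\<close> and
    \<open>p\<close>. There the square is that of a truncation, and compatibility of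
    \<open>\<epsilon>\<close> with the transitions brings it back to \<open>k\<close>.\<close>
  have "?u \<cdot>\<^bsub>D\<^esub> c k = d k \<cdot>\<^bsub>D\<^esub> \<epsilon> k" if k: "k \<ge> 1" for k
  proof -
    have max_eq: "k + (p - k) = p + (k - p)" by simp
    let ?j = "k - p" and ?i = "p - k"
    have s: "seq_comp D x s k ?i \<in> homset D (x k) (x (p + ?j))"
      and t: "seq_comp D y t k ?i \<in> homset D (y k) (y (p + ?j))"
      using s_hom[OF k, of ?i] t_hom[OF k, of ?i] unfolding max_eq .
    have "\<epsilon> (p + ?j) \<in> homset D (x (p + ?j)) (y (p + ?j))" using eps p by simp
    then have "?u \<cdot>\<^bsub>D\<^esub> c k = ?l' (q + ?j) \<cdot>\<^bsub>D\<^esub> (\<epsilon> (p + ?j) \<cdot>\<^bsub>D\<^esub> seq_comp D x s k ?i)"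
      unfolding c_def
      by (rule D.comp_square[OF tail(4) u _ tail(5) _ s]) (simp add: ul tail(3))
    also have "\<dots> = d k \<cdot>\<^bsub>D\<^esub> \<epsilon> k"
      unfolding d_def using seps[OF k, of ?i] D.comp_assoc[OF eps[OF k] t tail(5)] max_eq by simp
    finally show ?thesis .
  qed
  then have "is_direct_limit_map D (seq_system D {1..} x s) ?L c (seq_system D {1..} y t) ?L' d \<epsilon> ?u"
    using limS limT mor u unfolding is_direct_limit_map_def by (simp add: seq_system_def)
  moreover have "c k = ?l (nat (n + int k)) \<and> d k = ?l' (nat (n + int k))"
    if "k \<ge> 1" "n + int k \<ge> 0" for k
  proof -
    \<comment> \<open>In this range no transition is composed, so the leg is one of the limit system
      itself.\<close>
    have "k \<ge> p" using that by (simp add: p_def nat_le_iff)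
    then obtain j where j: "k = p + j" using le_Suc_ex by blast
    have "nat (n + int k) = q + j" using q j by simp
    then show ?thesis using tail(1,2)[of j] j by simp
  qed
  ultimately show ?thesis
    unfolding S T \<epsilon>_def[abs_def] by (auto simp: hat_cohfun_def)
qed

end

text \<open>The legs are prescribed wherever \<open>n + k\<close> is nonnegative; at the finitely
  many smaller indices the cocone condition determines them through the transitions, so the
  existential leaves no freedom at indices \<open>k \<ge> 1\<close>.\<close>

theorem theorem3p4:
  fixes C :: "('o1, 'm1) ab_cat" and D :: "('o2, 'm2) ab_cat"
    and T :: "('o1, 'm1, 'o2, 'm2) cohfun"
    and R :: "'o1 \<Rightarrow> 'm1 \<times> 'm1"
    and n :: int
  assumes "abelian_category C" and "enough_projectives C"
    and "abelian_category D" and "has_exact_direct_limits TYPE('i::infinite) D"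
    and "cohomological_functor C D T"
    and "\<forall>M\<in>Ob C. projective_presentation C M (R M)"
  shows "(\<forall>f g. short_exact C f g \<longrightarrow>
      (\<exists>c d.
        (\<forall>k\<ge>1. n + int k \<ge> 0 \<longrightarrow>
           c k = hat_leg C D R T n (Cod C g) (nat (n + int k)) \<and>
           d k = hat_leg C D R T (n + 1) (Dom C f) (nat (n + int k))) \<and>
        is_direct_limit_map D
          (conn_source_system C D R T n (Cod C g))
          (fob (cfun (hat_cohfun C D R T) n) (Cod C g)) c
          (conn_target_system C D R T n (Dom C f))
          (fob (cfun (hat_cohfun C D R T) (n + 1)) (Dom C f)) d
          (\<lambda>k. sat_conn C D R (cfun T (n + int k)) k f g)
          (conn (hat_cohfun C D R T) n f g))) \<and>
    (\<forall>i. natural_transformation C D (cfun T i) (sat1 C D R (cfun T (i + 1)))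
           (delta_under C D R T i))"
proof -
  interpret satellite_cohfun C D R T
    using assms by (simp add: satellite_cohfun_def satellite_setting_def
        satellite_setting_axioms_def satellite_cohfun_axioms_def)
  show ?thesis using hat_conn_limit[OF assms(4)] delta_under_natural by blast
qed

end
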